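(* Let $d,b\ge1$ with $M=2^b<d$, and $\varepsilon>0$. Consider the rotationally symmetric simplex codebooks $U^M=(rAs_1,\dots,rAs_M)$, $r>0$, with $A$ a uniformly (Haar) distributed $d\times d$ orthogonal matrix. Then there exist $k$ and $r>0$ such that the $k$-closest encoding with the codebook $(rAs_1,\dots,rAs_M)$ is unbiased and $\varepsilon$-LDP, and its worst-case error is at most $\mathrm{Err}(f,P_{U'^M})$ for every $r'>0$ and every random encoder $f$ that is unbiased and $\varepsilon$-LDP with respect to the codebook $U'^M=(r'As_1,\dots,r'As_M)$; i.e. the $k$-closest encoding is the exact-optimum unbiased $\varepsilon$-LDP scheme for the rotationally symmetric simplex codebook.
   Context: $\mathbb{S}^{d-1}$ is the unit sphere in $\mathbb{R}^d$, $[M]=\{1,\dots,M\}$. The simplex vectors $s_1,\dots,s_M\in\mathbb{R}^d$ are $(s_i)_j=\frac{M-1}{\sqrt{M(M-1)}}$ if $j=i$, $(s_i)_j=-\frac{1}{\sqrt{M(M-1)}}$ if $j\ne i$, $j\le M$, and $(s_i)_j=0$ if $j>M$. Server and user share the random codebook $U^M=(U_1,\dots,U_M)$; a random encoder $f:\mathbb{S}^{d-1}\times(\mathbb{R}^d)^M\to[M]$ has transition probabilities $Q_f(m\mid v,u^M)$, and the server decodes $m$ as $U_m$. The encoder is $\varepsilon$-LDP if $Q_f(m\mid v,u^M)\le e^\varepsilon Q_f(m\mid v',u^M)$ for all $v,v'\in\mathbb{S}^{d-1}$, $m$ and almost all $u^M$; unbiased if $\mathbb{E}[\sum_{m=1}^M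 U_mQ_f(m\mid v,U^M)]=v$ for all $v\in\mathbb{S}^{d-1}$; its worst-case error is $\mathrm{Err}(f,P_{U^M})=\sup_{v\in\mathbb{S}^{d-1}}\mathbb{E}[\sum_{m=1}^M\|U_m-v\|_2^2Q_f(m\mid v,U^M)]$. For real $k\in[0,M]$, the $k$-closest encoding sets $Q_f(m\mid v,U^M)=\frac{e^\varepsilon}{ke^\varepsilon+M-k}$ if $\|v-U_m\|^2$ is among the $\lfloor k\rfloor$ smallest of $\|v-U_1\|^2,\dots,\|v-U_M\|^2$, $\frac{(k-\lfloor k\rfloor)(e^\varepsilon-1)+1}{ke^\varepsilon+M-k}$ if it is the $(\lfloor k\rfloor+1)$-th smallest, and $\frac{1}{ke^\varepsilon+M-k}$ otherwise (ties broken arbitrarily). *)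

theory Defs
  imports "HOL-Probability.Probability"
begin

text \<open>Coordinates of the type 'd are ordered; the position (0-based) of a coordinate j
  is the number of coordinates strictly smaller than j. Thus d = CARD('d) and the
  coordinate at position p corresponds to the paper's index p+1.\<close>

definition coord_pos :: "'d::{finite,linorder} \<Rightarrow> nat" where
  "coord_pos j = card {j'. j' < j}"

definition simplex_vec :: "nat \<Rightarrow> nat \<Rightarrow> real^'d::{finite,linorder}" where
  "simplex_vec M i = (\<chi> j.
     if coord_pos j + 1 = i then (real M - 1) / sqrt (real M * (real M - 1))
     else if coord_pos j < M then - 1 / sqrt (real M * (real M - 1))
     else 0)"

definition simplex_codebook :: "nat \<Rightarrow> real \<Rightarrow> (real, 'd::{finite,linorder}) vec^'d::{finite,linorder} \<Rightarrow> nat \<Rightarrow> real^'d::{finite,linorder}" where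
  "simplex_codebook M r A = (\<lambda>m. r *\<^sub>R (A *v simplex_vec M m))"

text \<open>Haar (uniform) probability measure on the orthogonal group O(d): a Borel probability
  measure on d x d matrices concentrated on orthogonal matrices and invariant under left
  multiplication by orthogonal matrices (this characterizes the Haar measure uniquely).\<close>
definition haar_orthogonal :: "(real^'d^'d) measure \<Rightarrow> bool" where
  "haar_orthogonal \<mu> \<longleftrightarrow> prob_space \<mu> \<and> sets \<mu> = sets borel \<and>
     (AE A in \<mu>. orthogonal_matrix A) \<and>
     (\<forall>B. orthogonal_matrix B \<longrightarrow> distr \<mu> borel (\<lambda>A. B ** A) = \<mu>)"

text \<open>A random encoder is given by its transition probabilities Q v u m = Q_f(m | v, u^M),
  where u is the codebook (u 1, ..., u M). The random codebook is U A with A distributed as \<mu>.\<close>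
definition random_encoder ::
  "('a measure) \<Rightarrow> ('a \<Rightarrow> nat \<Rightarrow> real^'d) \<Rightarrow> nat \<Rightarrow>
   (real^'d \<Rightarrow> (nat \<Rightarrow> real^'d) \<Rightarrow> nat \<Rightarrow> real) \<Rightarrow> bool" where
  "random_encoder \<mu> U M Q \<longleftrightarrow>
     (\<forall>v\<in>sphere 0 1. \<forall>u. (\<forall>m\<in>{1..M}. 0 \<le> Q v u m) \<and> (\<Sum>m\<in>{1..M}. Q v u m) = 1) \<and>
     (\<forall>v\<in>sphere 0 1. \<forall>m\<in>{1..M}. (\<lambda>A. Q v (U A) m) \<in> borel_measurable \<mu>)"

definition is_ldp ::
  "('a measure) \<Rightarrow> ('a \<Rightarrow> nat \<Rightarrow> real^'d) \<Rightarrow> nat \<Rightarrow> real \<Rightarrow>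
   (real^'d \<Rightarrow> (nat \<Rightarrow> real^'d) \<Rightarrow> nat \<Rightarrow> real) \<Rightarrow> bool" where
  "is_ldp \<mu> U M \<epsilon> Q \<longleftrightarrow>
     (AE A in \<mu>. \<forall>v\<in>sphere 0 1. \<forall>v'\<in>sphere 0 1. \<forall>m\<in>{1..M}.
        Q v (U A) m \<le> exp \<epsilon> * Q v' (U A) m)"

definition is_unbiased ::
  "('a measure) \<Rightarrow> ('a \<Rightarrow> nat \<Rightarrow> real^'d) \<Rightarrow> nat \<Rightarrow>
   (real^'d \<Rightarrow> (nat \<Rightarrow> real^'d) \<Rightarrow> nat \<Rightarrow> real) \<Rightarrow> bool" where
  "is_unbiased \<mu> U M Q \<longleftrightarrow>
     (\<forall>v\<in>sphere 0 1. (\<integral>A. (\<Sum>m\<in>{1..M}. Q v (U A) m *\<^sub>R U A m) \<partial>\<mu>) = v)"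

definition worst_err ::
  "('a measure) \<Rightarrow> ('a \<Rightarrow> nat \<Rightarrow> real^'d) \<Rightarrow> nat \<Rightarrow>
   (real^'d \<Rightarrow> (nat \<Rightarrow> real^'d) \<Rightarrow> nat \<Rightarrow> real) \<Rightarrow> real" where
  "worst_err \<mu> U M Q =
     (SUP v\<in>sphere 0 1. \<integral>A. (\<Sum>m\<in>{1..M}. (norm (U A m - v))\<^sup>2 * Q v (U A) m) \<partial>\<mu>)"

definition closeness_rank :: "nat \<Rightarrow> real^'d \<Rightarrow> (nat \<Rightarrow> real^'d) \<Rightarrow> nat \<Rightarrow> nat" where
  "closeness_rank M v u m =
     card {m'\<in>{1..M}. (norm (v - u m'))\<^sup>2 < (norm (v - u m))\<^sup>2 \<or>
                       ((norm (v - u m'))\<^sup>2 = (norm (v - u m))\<^sup>2 \<and> m' < m)}"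

definition k_closest :: "real \<Rightarrow> nat \<Rightarrow> real \<Rightarrow> real^'d \<Rightarrow> (nat \<Rightarrow> real^'d) \<Rightarrow> nat \<Rightarrow> real" where
  "k_closest \<epsilon> M k v u m =
     (if m \<in> {1..M} then
        (if real (closeness_rank M v u m) < of_int \<lfloor>k\<rfloor> then
           exp \<epsilon> / (k * exp \<epsilon> + real M - k)
         else if real (closeness_rank M v u m) = of_int \<lfloor>k\<rfloor> then
           ((k - of_int \<lfloor>k\<rfloor>) * (exp \<epsilon> - 1) + 1) / (k * exp \<epsilon> + real M - k)
         else 1 / (k * exp \<epsilon> + real M - k))
      else 0)"

end

theory Submission
  imports Defs
begin

text \<open>For an unbiased encoder the cross term of the error is determined, so the error at every \<open>v\<close> is
  \<open>r\<^sup>2 - 1\<close> and the task is to minimise the scale \<open>r\<close>. Put \<open>x m = (A *v s m) \<bullet> v\<close>. For a fixed codebook an LDP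
  encoder takes values in \<open>[p m, exp \<epsilon> * p m]\<close>, and linear programming duality bounds \<open>\<Sum>m. Q m * x m\<close> by
  \<open>l + (\<Sum>m. p m * tilt \<epsilon> (x m - l))\<close> for every threshold \<open>l\<close>. With \<open>l\<close> an order statistic of \<open>x\<close>, averaging
  over Haar measure and over the permutation symmetry of the simplex leaves an affine function of \<open>\<Sum>m. p m\<close>
  which interpolates the values achieved by \<open>k\<close>-closest encoding with consecutive integers \<open>k\<close>. Hence
  \<open>1 \<le> r * Max (gain k)\<close>, with equality for \<open>k\<close>-closest encoding with the maximising \<open>k\<close>.\<close>

subsection \<open>Ranks, order statistics and top-weight allocations\<close>

text \<open>Equal values are ranked by index, the rule of \<open>closeness_rank\<close>. Ranks of
  negated squared distances are therefore exactly closeness ranks, and ranking is a bijection even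
  with ties.\<close>

definition desc_rank :: "nat \<Rightarrow> (nat \<Rightarrow> real) \<Rightarrow> nat \<Rightarrow> nat" where
  "desc_rank M x m = card {n\<in>{1..M}. x m < x n \<or> (x n = x m \<and> n < m)}"

definition order_stat :: "nat \<Rightarrow> (nat \<Rightarrow> real) \<Rightarrow> nat \<Rightarrow> real" where
  "order_stat M x i = x (inv_into {1..M} (desc_rank M x) i)"

lemma desc_rank_less:
  assumes "n \<in> {1..M}" and "x m < x n \<or> (x n = x m \<and> n < m)"
  shows "desc_rank M x n < desc_rank M x m"
proof -
  let ?P = "\<lambda>m n. x m < x n \<or> (x n = x m \<and> n < m)"
  have "{n'\<in>{1..M}. ?P n n'} \<subseteq> {n'\<in>{1..M}. ?P m n'}"
    using assms(2) by (auto simp del: atLeastAtMost_iff)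
  moreover have "n \<in> {n'\<in>{1..M}. ?P m n'}" using assms by blast
  moreover have "n \<notin> {n'\<in>{1..M}. ?P n n'}" by simp
  ultimately have "{n'\<in>{1..M}. ?P n n'} \<subset> {n'\<in>{1..M}. ?P m n'}" by blast
  then show ?thesis unfolding desc_rank_def by (intro psubset_card_mono) simp_all
qed

lemma inj_on_desc_rank: "inj_on (desc_rank M x) {1..M}"
proof (rule inj_onI)
  fix n m assume *: "n \<in> {1..M}" "m \<in> {1..M}" "desc_rank M x n = desc_rank M x m"
  have "\<not> (x m < x n \<or> (x n = x m \<and> n < m))"
    using desc_rank_less[of n M x m] * by force
  moreover have "\<not> (x n < x m \<or> (x m = x n \<and> m < n))"
    using desc_rank_less[of m M x n] * by force
  ultimately show "n = m" by linarith
qed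

lemma desc_rank_image: "desc_rank M x ` {1..M} = {..<M}"
proof (rule card_subset_eq)
  have "desc_rank M x m < M" if m: "m \<in> {1..M}" for m
  proof -
    have "desc_rank M x m \<le> card ({1..M} - {m})"
      unfolding desc_rank_def by (intro card_mono) auto
    also have "\<dots> < M" using m by (auto simp: card_Diff_singleton)
    finally show ?thesis .
  qed
  then show "desc_rank M x ` {1..M} \<subseteq> {..<M}" by blast
  show "card (desc_rank M x ` {1..M}) = card {..<M}"
    unfolding card_image[OF inj_on_desc_rank] by simp
qed simp

text \<open>Superlevel sets are initial segments of the ranking, so membership is decided by
  comparing the rank with the size of the set.\<close>

lemma le_iff_desc_rank_less:
  assumes "m \<in> {1..M}"
  shows "c \<le> x m \<longleftrightarrow> desc_rank M x m < card {n\<in>{1..M}. c \<le> x n}"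
proof
  assume c: "c \<le> x m"
  let ?R = "{n\<in>{1..M}. x m < x n \<or> (x n = x m \<and> n < m)}"
  have "?R \<subseteq> {n\<in>{1..M}. c \<le> x n}" using c by force
  moreover have "m \<in> {n\<in>{1..M}. c \<le> x n}" using c assms by blast
  moreover have "m \<notin> ?R" by simp
  ultimately have "?R \<subset> {n\<in>{1..M}. c \<le> x n}" by blast
  then show "desc_rank M x m < card {n\<in>{1..M}. c \<le> x n}"
    unfolding desc_rank_def by (intro psubset_card_mono) simp_all
next
  assume *: "desc_rank M x m < card {n\<in>{1..M}. c \<le> x n}"
  show "c \<le> x m"
  proof (rule ccontr)
    assume "\<not> c \<le> x m"
    then have "{n\<in>{1..M}. c \<le> x n} \<subseteq> {n\<in>{1..M}. x m < x n \<or> (x n = x m \<and> n < m)}"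
      by force
    then have "card {n\<in>{1..M}. c \<le> x n} \<le> desc_rank M x m"
      unfolding desc_rank_def by (intro card_mono) simp_all
    then show False using * by simp
  qed
qed

lemma order_stat_obtain:
  assumes "i < M"
  obtains m where "m \<in> {1..M}" "desc_rank M x m = i" "order_stat M x i = x m"
proof
  have i: "i \<in> desc_rank M x ` {1..M}" using assms unfolding desc_rank_image by simp
  show "inv_into {1..M} (desc_rank M x) i \<in> {1..M}" by (rule inv_into_into[OF i])
  show "desc_rank M x (inv_into {1..M} (desc_rank M x) i) = i" by (rule f_inv_into_f[OF i])
qed (simp add: order_stat_def)

text \<open>A description free of ranks and tie-breaking: only sizes of superlevel sets enter.
  Permutation invariance and Borel measurability of order statistics both follow from it.\<close>

lemma le_order_stat_iff:
  assumes "i < M"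
  shows "c \<le> order_stat M x i \<longleftrightarrow> i < card {n\<in>{1..M}. c \<le> x n}"
proof -
  obtain m where "m \<in> {1..M}" "desc_rank M x m = i" "order_stat M x i = x m"
    by (rule order_stat_obtain[OF assms, of x])
  then show ?thesis using le_iff_desc_rank_less[of m M c x] by simp
qed

lemma order_stat_permute:
  assumes "i < M" and "bij_betw \<sigma> {1..M} {1..M}"
  shows "order_stat M (\<lambda>m. x (\<sigma> m)) i = order_stat M x i"
proof -
  have "card {n\<in>{1..M}. c \<le> x (\<sigma> n)} = card {n\<in>{1..M}. c \<le> x n}" for c
  proof (rule bij_betw_same_card)
    show "bij_betw \<sigma> {n\<in>{1..M}. c \<le> x (\<sigma> n)} {n\<in>{1..M}. c \<le> x n}"
    proof (rule bij_betw_imageI)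
      show "inj_on \<sigma> {n\<in>{1..M}. c \<le> x (\<sigma> n)}"
        by (rule inj_on_subset[OF bij_betw_imp_inj_on[OF assms(2)]]) auto
      have "\<sigma> ` {n\<in>{1..M}. c \<le> x (\<sigma> n)} = {n\<in>\<sigma> ` {1..M}. c \<le> x n}"
        by blast
      then show "\<sigma> ` {n\<in>{1..M}. c \<le> x (\<sigma> n)} = {n\<in>{1..M}. c \<le> x n}"
        unfolding bij_betw_imp_surj_on[OF assms(2)] .
    qed
  qed
  then have "c \<le> order_stat M (\<lambda>m. x (\<sigma> m)) i \<longleftrightarrow> c \<le> order_stat M x i" for c
    by (simp add: le_order_stat_iff[OF assms(1)])
  then show ?thesis by (meson order.antisym order.refl)
qed

lemma order_stat_le:
  assumes "i < M" "m \<in> {1..M}" "desc_rank M x m \<le> i"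
  shows "order_stat M x i \<le> x m"
proof -
  obtain n where n: "n \<in> {1..M}" "desc_rank M x n = i" "order_stat M x i = x n"
    by (rule order_stat_obtain[OF assms(1), of x])
  show ?thesis using desc_rank_less[of n M x m] n assms(3) by linarith
qed

lemma le_order_stat:
  assumes "i < M" "m \<in> {1..M}" "i \<le> desc_rank M x m"
  shows "x m \<le> order_stat M x i"
proof -
  obtain n where n: "n \<in> {1..M}" "desc_rank M x n = i" "order_stat M x i = x n"
    by (rule order_stat_obtain[OF assms(1), of x])
  show ?thesis using desc_rank_less[of m M x n] n assms(2,3) by linarith
qed

lemma order_stat_abs_le:
  assumes "i < M" "\<And>m. m \<in> {1..M} \<Longrightarrow> \<bar>x m\<bar> \<le> c"
  shows "\<bar>order_stat M x i\<bar> \<le> c"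
proof -
  obtain m where "m \<in> {1..M}" "order_stat M x i = x m"
    by (rule order_stat_obtain[OF assms(1), of x])
  then show ?thesis using assms(2)[of m] by simp
qed

lemma card_desc_rank_less:
  assumes "k \<le> M"
  shows "card {m\<in>{1..M}. desc_rank M x m < k} = k"
proof -
  have "desc_rank M x ` {m\<in>{1..M}. desc_rank M x m < k} = desc_rank M x ` {1..M} \<inter> {..<k}"
    by blast
  also have "\<dots> = {..<k}" using assms unfolding desc_rank_image by auto
  finally have "desc_rank M x ` {m\<in>{1..M}. desc_rank M x m < k} = {..<k}" .
  moreover have "inj_on (desc_rank M x) {m\<in>{1..M}. desc_rank M x m < k}"
    by (rule inj_on_subset[OF inj_on_desc_rank]) auto
  ultimately show ?thesis by (metis card_image card_lessThan)
qed

lemma borel_measurable_order_stat [measurable (raw)]: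
  fixes x :: "'a \<Rightarrow> nat \<Rightarrow> real"
  assumes "i < M" and [measurable]: "\<And>m. (\<lambda>a. x a m) \<in> borel_measurable N"
  shows "(\<lambda>a. order_stat M (x a) i) \<in> borel_measurable N"
proof -
  have "(\<lambda>a. card {n\<in>{1..M}. c \<le> x a n}) \<in> measurable N (count_space UNIV)" for c
    by (rule measurable_card) simp
  then show ?thesis
    unfolding borel_measurable_iff_ge le_order_stat_iff[OF assms(1)]
    by measurable
qed

lemma measurable_desc_rank [measurable (raw)]:
  fixes x :: "'a \<Rightarrow> nat \<Rightarrow> real"
  assumes [measurable]: "\<And>m. (\<lambda>a. x a m) \<in> borel_measurable N"
  shows "(\<lambda>a. desc_rank M (x a) m) \<in> measurable N (count_space UNIV)"
  unfolding desc_rank_def by (rule measurable_card) simp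

section \<open>Two-level allocations and the dual threshold bound\<close>

definition total_weight :: "real \<Rightarrow> nat \<Rightarrow> nat \<Rightarrow> real" where
  "total_weight \<epsilon> M k = real k * exp \<epsilon> + real M - real k"

definition top_weight :: "real \<Rightarrow> nat \<Rightarrow> nat \<Rightarrow> (nat \<Rightarrow> real) \<Rightarrow> nat \<Rightarrow> real" where
  "top_weight \<epsilon> M k x m = (if desc_rank M x m < k then exp \<epsilon> else 1) / total_weight \<epsilon> M k"

definition top_value :: "real \<Rightarrow> nat \<Rightarrow> nat \<Rightarrow> (nat \<Rightarrow> real) \<Rightarrow> real" where
  "top_value \<epsilon> M k x = (\<Sum>m\<in>{1..M}. top_weight \<epsilon> M k x m * x m)"

text \<open>For \<open>p \<ge> 0\<close> and \<open>\<epsilon> \<ge> 0\<close>,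
  \<open>p * tilt \<epsilon> y\<close> is the largest value of \<open>q * y\<close> subject to
  \<open>p \<le> q \<le> exp \<epsilon> * p\<close>.\<close>

definition tilt :: "real \<Rightarrow> real \<Rightarrow> real" where
  "tilt \<epsilon> y = (if 0 \<le> y then exp \<epsilon> * y else y)"

lemma total_weight_pos:
  assumes "0 < M" "k \<le> M"
  shows "0 < total_weight \<epsilon> M k"
proof (cases "k = M")
  case True
  then show ?thesis using assms by (simp add: total_weight_def)
next
  case False
  then have "0 \<le> real k * exp \<epsilon>" "real k < real M" using assms by auto
  then show ?thesis unfolding total_weight_def by linarith
qed

lemma sum_top_weight:
  assumes "0 < M" "k \<le> M"
  shows "(\<Sum>m\<in>{1..M}. top_weight \<epsilon> M k x m) = 1"
proof -
  let ?S = "{m\<in>{1..M}. desc_rank M x m < k}"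
  have "(\<Sum>m\<in>{1..M}. if desc_rank M x m < k then exp \<epsilon> else 1)
      = (\<Sum>m\<in>{1..M}. 1 + (if desc_rank M x m < k then exp \<epsilon> - 1 else 0))"
    by (rule sum.cong) auto
  also have "\<dots> = real M + real (card ?S) * (exp \<epsilon> - 1)"
    by (simp add: sum.distrib sum.If_cases Int_def conj_commute)
  also have "\<dots> = total_weight \<epsilon> M k"
    unfolding card_desc_rank_less[OF assms(2)] total_weight_def by (simp add: algebra_simps)
  finally show ?thesis
    using total_weight_pos[OF assms, of \<epsilon>]
    by (simp add: top_weight_def flip: sum_divide_distrib)
qed

text \<open>Complementary slackness: entries of rank below \<open>i\<close> are at least the
  threshold and those of rank above \<open>i\<close> at most it, so the high weight on the first
  \<open>k\<close> ranks agrees with the slopes of \<open>tilt\<close>. The entry of rank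
  \<open>i\<close> contributes zero, which is why \<open>k = i\<close> and \<open>k = Suc i\<close>
  share one threshold.\<close>

lemma top_value_eq_threshold:
  assumes "i < M" "k = i \<or> k = Suc i"
  shows "top_value \<epsilon> M k x = order_stat M x i
    + (\<Sum>m\<in>{1..M}. tilt \<epsilon> (x m - order_stat M x i)) / total_weight \<epsilon> M k"
proof -
  let ?l = "order_stat M x i"
  have k: "0 < M" "k \<le> M" using assms by auto
  have "top_weight \<epsilon> M k x m * (x m - ?l) = tilt \<epsilon> (x m - ?l) / total_weight \<epsilon> M k"
    if m: "m \<in> {1..M}" for m
  proof (cases "desc_rank M x m < k")
    case True
    then have "?l \<le> x m" using order_stat_le[OF assms(1) m] assms(2) by auto
    then show ?thesis using True by (simp add: top_weight_def tilt_def)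
  next
    case False
    then have "x m \<le> ?l" using le_order_stat[OF assms(1) m] assms(2) by auto
    then show ?thesis using False by (simp add: top_weight_def tilt_def)
  qed
  then have "(\<Sum>m\<in>{1..M}. top_weight \<epsilon> M k x m * (x m - ?l))
      = (\<Sum>m\<in>{1..M}. tilt \<epsilon> (x m - ?l)) / total_weight \<epsilon> M k"
    by (simp add: sum_divide_distrib)
  moreover have "(\<Sum>m\<in>{1..M}. top_weight \<epsilon> M k x m * (x m - ?l))
      = top_value \<epsilon> M k x - ?l"
    using sum_top_weight[OF k, of \<epsilon> x]
    by (simp add: top_value_def right_diff_distrib sum_subtractf flip: sum_distrib_right)
  ultimately show ?thesis by simp
qed

text \<open>Weak duality, with \<open>l\<close> the multiplier of the constraint that
  \<open>q\<close> sums to one: after subtracting \<open>l\<close> each term is bounded by the end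
  of the interval for \<open>q m\<close> selected by the sign of \<open>x m - l\<close>.\<close>

lemma weighted_sum_le_threshold:
  fixes p q x :: "nat \<Rightarrow> real"
  assumes "\<And>m. m \<in> I \<Longrightarrow> p m \<le> q m" "\<And>m. m \<in> I \<Longrightarrow> q m \<le> exp \<epsilon> * p m" "(\<Sum>m\<in>I. q m) = 1"
  shows "(\<Sum>m\<in>I. q m * x m) \<le> l + (\<Sum>m\<in>I. p m * tilt \<epsilon> (x m - l))"
proof -
  have "q m * (x m - l) \<le> p m * tilt \<epsilon> (x m - l)" if "m \<in> I" for m
    using assms(1,2)[OF that] mult_right_mono[of "q m" "exp \<epsilon> * p m" "x m - l"]
      mult_right_mono_neg[of "p m" "q m" "x m - l"]
    by (auto simp: tilt_def algebra_simps)
  then have "(\<Sum>m\<in>I. q m * (x m - l)) \<le> (\<Sum>m\<in>I. p m * tilt \<epsilon> (x m - l))"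
    by (rule sum_mono)
  moreover have "(\<Sum>m\<in>I. q m * (x m - l)) = (\<Sum>m\<in>I. q m * x m) - l"
    using assms(3) by (simp add: right_diff_distrib sum_subtractf flip: sum_distrib_right)
  ultimately show ?thesis by simp
qed

text \<open>A discrete intermediate value argument, by induction on the upper end. Applied to
  \<open>M / T\<close>, with \<open>T\<close> the total floor mass, it finds the two consecutive
  integers between which to interpolate.\<close>

lemma total_weight_bracket:
  assumes "0 < M" "total_weight \<epsilon> M 0 \<le> z" "z \<le> total_weight \<epsilon> M M"
  obtains i where "i < M" "total_weight \<epsilon> M i \<le> z" "z \<le> total_weight \<epsilon> M (Suc i)"
proof -
  have "\<exists>i<n. total_weight \<epsilon> M i \<le> z \<and> z \<le> total_weight \<epsilon> M (Suc i)"
    if "0 < n" "z \<le> total_weight \<epsilon> M n" for n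
    using that
  proof (induction n)
    case (Suc n)
    show ?case
    proof (cases "z \<le> total_weight \<epsilon> M n \<and> 0 < n")
      case True
      then show ?thesis using Suc.IH less_SucI by blast
    next
      case False
      then have "total_weight \<epsilon> M n \<le> z" using assms(2) by force
      then show ?thesis using Suc.prems by blast
    qed
  qed simp
  from this[OF assms(1,3)] show ?thesis using that by blast
qed

lemma affine_le_endpoint_max:
  fixes \<alpha> \<beta> c t t1 t2 :: real
  assumes "t1 \<le> t" "t \<le> t2" "\<alpha> + t1 * \<beta> \<le> c" "\<alpha> + t2 * \<beta> \<le> c"
  shows "\<alpha> + t * \<beta> \<le> c"
proof (cases "0 \<le> \<beta>")
  case True
  then show ?thesis using mult_right_mono[OF assms(2) True] assms by linarith
next
  case False
  then show ?thesis using mult_right_mono_neg[OF assms(1), of \<beta>] assms by linarith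
qed

lemma borel_measurable_tilt [measurable (raw)]:
  assumes [measurable]: "f \<in> borel_measurable N"
  shows "(\<lambda>a. tilt \<epsilon> (f a)) \<in> borel_measurable N"
  unfolding tilt_def by measurable

lemma abs_tilt_le:
  assumes "0 < \<epsilon>"
  shows "\<bar>tilt \<epsilon> y\<bar> \<le> exp \<epsilon> * \<bar>y\<bar>"
  using assms mult_right_mono[of 1 "exp \<epsilon>" "\<bar>y\<bar>"] by (auto simp: tilt_def abs_mult)

lemma desc_rank_cong:
  assumes "m \<in> {1..M}"
    and "\<And>n n'. n \<in> {1..M} \<Longrightarrow> n' \<in> {1..M} \<Longrightarrow> x n < x n' \<longleftrightarrow> y n < y n'"
  shows "desc_rank M x m = desc_rank M y m"
proof -
  have "x m < x n \<or> (x n = x m \<and> n < m) \<longleftrightarrow> y m < y n \<or> (y n = y m \<and> n < m)"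
    if "n \<in> {1..M}" for n
    using assms(2)[OF assms(1) that] assms(2)[OF that assms(1)] by (metis linorder_neqE)
  then show ?thesis unfolding desc_rank_def by (intro arg_cong[where f = card]) blast
qed

text \<open>For integer \<open>k\<close> the fractional part vanishes, so the intermediate
  probability equals the lowest one and only two levels remain.\<close>

lemma k_closest_eq_top_weight:
  assumes "m \<in> {1..M}"
  shows "k_closest \<epsilon> M (real k) v u m = top_weight \<epsilon> M k (\<lambda>n. - (norm (v - u n))\<^sup>2) m"
proof -
  have "closeness_rank M v u m = desc_rank M (\<lambda>n. - (norm (v - u n))\<^sup>2) m"
    by (simp add: closeness_rank_def desc_rank_def)
  then show ?thesis
    using assms by (simp add: k_closest_def top_weight_def total_weight_def)
qed

lemma top_weight_nonneg: "0 < M \<Longrightarrow> k \<le> M \<Longrightarrow> 0 \<le> top_weight \<epsilon> M k x m"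
  using total_weight_pos[of M k \<epsilon>] by (simp add: top_weight_def)

lemma borel_measurable_top_weight [measurable (raw)]:
  fixes x :: "'a \<Rightarrow> nat \<Rightarrow> real"
  assumes [measurable]: "\<And>m. (\<lambda>a. x a m) \<in> borel_measurable N"
  shows "(\<lambda>a. top_weight \<epsilon> M k (x a) m) \<in> borel_measurable N"
  unfolding top_weight_def by measurable

subsection \<open>Orthogonal matrices and Haar measure\<close>

lemma inner_orthogonal_matrix:
  fixes A :: "real^'n^'n"
  assumes "orthogonal_matrix A"
  shows "(A *v x) \<bullet> (A *v y) = x \<bullet> y"
  using assms orthogonal_transformation_matrix[of "(*v) A"]
  by (simp add: orthogonal_transformation_def)

lemma norm_orthogonal_matrix:
  fixes A :: "real^'n^'n"
  assumes "orthogonal_matrix A"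
  shows "norm (A *v x) = norm x"
  using inner_orthogonal_matrix[OF assms, of x x] by (simp add: norm_eq_sqrt_inner)

lemma inner_transpose:
  fixes A :: "real^'n^'n"
  shows "x \<bullet> (transpose A *v y) = (A *v x) \<bullet> y"
  by (metis dot_lmul_matrix inner_commute transpose_matrix_vector)

lemma orthogonal_matrix_exists:
  fixes a b :: "real^'n"
  assumes "norm a = norm b"
  obtains B where "orthogonal_matrix B" "B *v a = b"
proof -
  obtain f where f: "orthogonal_transformation f" "f a = b"
    using orthogonal_transformation_exists[OF assms] .
  then have "orthogonal_matrix (matrix f)" "matrix f *v a = b"
    using orthogonal_transformation_matrix[of f] by (simp_all add: matrix_works)
  then show ?thesis by (rule that)
qed

lemma continuous_on_matrix_matrix_mult [continuous_intros]:
  fixes f :: "'a::topological_space \<Rightarrow> real^'n^'m" and g :: "'a \<Rightarrow> real^'k^'n"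
  assumes "continuous_on S f" "continuous_on S g"
  shows "continuous_on S (\<lambda>x. f x ** g x)"
  unfolding matrix_matrix_mult_def by (intro continuous_intros assms)

lemma continuous_on_matrix_vector_mult [continuous_intros]:
  fixes f :: "'a::topological_space \<Rightarrow> real^'n^'m" and g :: "'a \<Rightarrow> real^'n"
  assumes "continuous_on S f" "continuous_on S g"
  shows "continuous_on S (\<lambda>x. f x *v g x)"
  unfolding matrix_vector_mult_def by (intro continuous_intros assms)

lemma continuous_on_transpose [continuous_intros]:
  fixes f :: "'a::topological_space \<Rightarrow> real^'n^'m"
  assumes "continuous_on S f"
  shows "continuous_on S (\<lambda>x. transpose (f x))"
  unfolding transpose_def by (intro continuous_intros assms)

lemma borel_measurable_matrix_matrix_mult [measurable (raw)]:
  fixes f :: "'a \<Rightarrow> real^'n^'m" and g :: "'a \<Rightarrow> real^'k^'n"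
  assumes "f \<in> borel_measurable N" "g \<in> borel_measurable N"
  shows "(\<lambda>x. f x ** g x) \<in> borel_measurable N"
  by (rule borel_measurable_continuous_Pair[OF assms]) (intro continuous_intros)

lemma borel_measurable_matrix_vector_mult [measurable (raw)]:
  fixes f :: "'a \<Rightarrow> real^'n^'m" and g :: "'a \<Rightarrow> real^'n"
  assumes "f \<in> borel_measurable N" "g \<in> borel_measurable N"
  shows "(\<lambda>x. f x *v g x) \<in> borel_measurable N"
  by (rule borel_measurable_continuous_Pair[OF assms]) (intro continuous_intros)

lemma borel_measurable_transpose [measurable (raw)]:
  fixes f :: "'a \<Rightarrow> real^'n^'m"
  assumes "f \<in> borel_measurable N"
  shows "(\<lambda>x. transpose (f x)) \<in> borel_measurable N"
  by (rule borel_measurable_continuous_on[OF _ assms]) (intro continuous_intros)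

section \<open>Invariance properties of Haar measure\<close>

locale haar_measure =
  fixes \<mu> :: "(real^'d^'d) measure"
  assumes haar: "haar_orthogonal \<mu>"
begin

sublocale prob_space \<mu>
  using haar by (simp add: haar_orthogonal_def)

lemma sets_eq [measurable_cong, simp]: "sets \<mu> = sets borel"
  using haar by (simp add: haar_orthogonal_def)

lemma space_eq [simp]: "space \<mu> = UNIV"
  using sets_eq_imp_space_eq[OF sets_eq] by simp

lemma prob_UNIV [simp]: "prob UNIV = 1"
  using prob_space by simp

lemma AE_orthogonal: "AE A in \<mu>. orthogonal_matrix A"
  using haar by (simp add: haar_orthogonal_def)

lemma distr_left_mult: "orthogonal_matrix B \<Longrightarrow> distr \<mu> borel (\<lambda>A. B ** A) = \<mu>"
  using haar by (simp add: haar_orthogonal_def)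

lemma nn_integral_left_mult:
  assumes "orthogonal_matrix B" and [measurable]: "f \<in> borel_measurable borel"
  shows "(\<integral>\<^sup>+A. f (B ** A) \<partial>\<mu>) = (\<integral>\<^sup>+A. f A \<partial>\<mu>)"
proof -
  have "(\<integral>\<^sup>+A. f A \<partial>distr \<mu> borel (\<lambda>A. B ** A)) = (\<integral>\<^sup>+A. f (B ** A) \<partial>\<mu>)"
    by (rule nn_integral_distr) measurable
  then show ?thesis by (simp add: distr_left_mult[OF assms(1)])
qed

lemma integral_left_mult:
  fixes f :: "_ \<Rightarrow> 'b::{banach, second_countable_topology}"
  assumes "orthogonal_matrix B" and [measurable]: "f \<in> borel_measurable borel"
  shows "(\<integral>A. f (B ** A) \<partial>\<mu>) = (\<integral>A. f A \<partial>\<mu>)"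
proof -
  have "(\<integral>A. f A \<partial>distr \<mu> borel (\<lambda>A. B ** A)) = (\<integral>A. f (B ** A) \<partial>\<mu>)"
    by (rule integral_distr) measurable
  then show ?thesis by (simp add: distr_left_mult[OF assms(1)])
qed

text \<open>Invariance is assumed only on the left. To pass to the transpose, integrate the
  indicator of \<open>transpose A ** B \<in> S\<close> over independent \<open>A\<close> and
  \<open>B\<close>. With \<open>B\<close> innermost, left invariance gives the measure of
  \<open>S\<close>; with \<open>A\<close> innermost, the product is the transpose of
  \<open>transpose B ** A\<close>, and left invariance gives the transposed law.\<close>

lemma distr_transpose: "distr \<mu> borel transpose = \<mu>"
proof (rule measure_eqI)
  fix S assume "S \<in> sets (distr \<mu> borel transpose)"
  then have S [measurable]: "S \<in> sets borel" by simp
  interpret P: pair_sigma_finite \<mu> \<mu> ..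
  have "emeasure \<mu> S = (\<integral>\<^sup>+A. emeasure \<mu> S \<partial>\<mu>)"
    by (simp add: emeasure_space_1 flip: space_eq)
  also have "\<dots> = (\<integral>\<^sup>+A. \<integral>\<^sup>+B. indicator S (transpose A ** B) \<partial>\<mu> \<partial>\<mu>)"
  proof (rule nn_integral_cong_AE, use AE_orthogonal in eventually_elim)
    fix A :: "real^'d^'d" assume "orthogonal_matrix A"
    then show "emeasure \<mu> S = (\<integral>\<^sup>+B. indicator S (transpose A ** B) \<partial>\<mu>)"
      using nn_integral_left_mult[of "transpose A" "indicator S"] by simp
  qed
  also have "\<dots> = (\<integral>\<^sup>+B. \<integral>\<^sup>+A. indicator S (transpose A ** B) \<partial>\<mu> \<partial>\<mu>)"
    by (rule P.Fubini'[symmetric]) measurable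
  also have "\<dots> = (\<integral>\<^sup>+B. emeasure (distr \<mu> borel transpose) S \<partial>\<mu>)"
  proof (rule nn_integral_cong_AE, use AE_orthogonal in eventually_elim)
    fix B :: "real^'d^'d" assume B: "orthogonal_matrix B"
    have "(\<integral>\<^sup>+A. indicator S (transpose A ** B) \<partial>\<mu>)
        = (\<integral>\<^sup>+A. indicator S (transpose (transpose B ** A)) \<partial>\<mu>)"
      by (simp add: matrix_transpose_mul)
    also have "\<dots> = (\<integral>\<^sup>+A. indicator S (transpose A) \<partial>\<mu>)"
      by (rule nn_integral_left_mult[where f = "\<lambda>A. indicator S (transpose A)"]) (use B in simp_all)
    also have "\<dots> = (\<integral>\<^sup>+A. indicator S A \<partial>distr \<mu> borel transpose)"
      by (subst nn_integral_distr) simp_all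
    also have "\<dots> = emeasure (distr \<mu> borel transpose) S" by simp
    finally show "(\<integral>\<^sup>+A. indicator S (transpose A ** B) \<partial>\<mu>) = \<dots>" .
  qed
  also have "\<dots> = emeasure (distr \<mu> borel transpose) S"
    by (simp add: emeasure_space_1 flip: space_eq)
  finally show "emeasure (distr \<mu> borel transpose) S = emeasure \<mu> S" ..
qed simp

lemma integral_transpose:
  fixes f :: "_ \<Rightarrow> 'b::{banach, second_countable_topology}"
  assumes [measurable]: "f \<in> borel_measurable borel"
  shows "(\<integral>A. f (transpose A) \<partial>\<mu>) = (\<integral>A. f A \<partial>\<mu>)"
proof -
  have "(\<integral>A. f A \<partial>distr \<mu> borel transpose) = (\<integral>A. f (transpose A) \<partial>\<mu>)"
    by (rule integral_distr) measurable
  then show ?thesis by (simp add: distr_transpose)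
qed

text \<open>Both vectors are uniform on the same sphere: a rotation taking \<open>w\<close> to
  \<open>v\<close> is absorbed by left invariance, and the transpose by
  \<open>integral_transpose\<close>. This reduces every input to one reference vector.\<close>

lemma integral_apply_sphere:
  fixes F :: "real^'d \<Rightarrow> 'b::{banach, second_countable_topology}"
  assumes "norm v = norm w" and [measurable]: "F \<in> borel_measurable borel"
  shows "(\<integral>A. F (transpose A *v v) \<partial>\<mu>) = (\<integral>A. F (A *v w) \<partial>\<mu>)"
proof -
  obtain B where B: "orthogonal_matrix B" "B *v w = v"
    using orthogonal_matrix_exists[of w v] assms(1) by metis
  have "transpose B *v v = w"
    using B by (metis matrix_vector_mul_assoc matrix_vector_mul_lid orthogonal_matrix)
  then have "transpose (B ** A) *v v = transpose A *v w" for A :: "real^'d^'d"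
    by (simp add: matrix_transpose_mul del: transpose_matrix_vector flip: matrix_vector_mul_assoc)
  moreover have "(\<integral>A. F (transpose (B ** A) *v v) \<partial>\<mu>) = (\<integral>A. F (transpose A *v v) \<partial>\<mu>)"
    by (rule integral_left_mult[OF B(1), where f = "\<lambda>A. F (transpose A *v v)"]) measurable
  moreover have "(\<integral>A. F (transpose A *v w) \<partial>\<mu>) = (\<integral>A. F (A *v w) \<partial>\<mu>)"
    by (rule integral_transpose[where f = "\<lambda>A. F (A *v w)"]) measurable
  ultimately show ?thesis by simp
qed

end

subsection \<open>The simplex\<close>

text \<open>Sums over the index type become sums over positions, where the simplex vectors are given
  by cases.\<close>

lemma bij_betw_coord_pos: "bij_betw coord_pos (UNIV :: 'd::{finite,linorder} set) {..<CARD('d)}"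
proof -
  have less: "coord_pos i < coord_pos j" if "i < j" for i j :: 'd
    unfolding coord_pos_def
  proof (intro psubset_card_mono)
    have "{j'. j' < i} \<subseteq> {j'. j' < j}" "i \<in> {j'. j' < j}" "i \<notin> {j'. j' < i}"
      using that by auto
    then show "{j'. j' < i} \<subset> {j'. j' < j}" by blast
  qed simp
  have inj: "inj (coord_pos :: 'd \<Rightarrow> nat)"
  proof (rule injI)
    fix i j :: 'd assume "coord_pos i = coord_pos j"
    then show "i = j" using less[of i j] less[of j i] by (cases i j rule: linorder_cases) auto
  qed
  have "coord_pos j < CARD('d)" for j :: 'd
    unfolding coord_pos_def by (intro psubset_card_mono) auto
  then have "range (coord_pos :: 'd \<Rightarrow> nat) \<subseteq> {..<CARD('d)}" by blast
  then have "range (coord_pos :: 'd \<Rightarrow> nat) = {..<CARD('d)}"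
    by (rule card_subset_eq[rotated]) (simp_all add: card_image[OF inj])
  then show ?thesis using inj by (simp add: bij_betw_def)
qed

lemma inner_simplex_vec_self:
  assumes "i \<in> {1..M}" "2 \<le> M" "M \<le> CARD('d::{finite,linorder})"
  shows "simplex_vec M i \<bullet> (simplex_vec M i :: real^'d::{finite,linorder}) = 1"
proof -
  define h :: "nat \<Rightarrow> real" where
    "h = (\<lambda>p. if p + 1 = i then (real M - 1) / sqrt (real M * (real M - 1))
      else if p < M then - 1 / sqrt (real M * (real M - 1)) else 0)"
  have sq: "(sqrt (real M * (real M - 1)))\<^sup>2 = real M * (real M - 1)"
    using assms(2) by (intro real_sqrt_pow2) simp
  have c: "real (card ({..<M} - {i - 1})) = real M - 1"
    using assms by (subst card_Diff_singleton) (auto simp: of_nat_diff)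
  have "simplex_vec M i \<bullet> (simplex_vec M i :: (real, 'd) vec) = (\<Sum>j\<in>UNIV. (h (coord_pos (j::'d)))\<^sup>2)"
    by (simp add: inner_vec_def simplex_vec_def h_def power2_eq_square)
  also have "\<dots> = (\<Sum>p<CARD('d). (h p)\<^sup>2)"
    by (rule sum.reindex_bij_betw[OF bij_betw_coord_pos])
  also have "\<dots> = (\<Sum>p<M. (h p)\<^sup>2)"
    by (rule sum.mono_neutral_right) (use assms in \<open>auto simp: h_def\<close>)
  \<comment> \<open>Codewords are numbered from 1 and positions from 0, so the exceptional
    coordinate sits at position \<open>i - 1\<close>.\<close>
  also have "\<dots> = (h (i - 1))\<^sup>2 + (\<Sum>p\<in>{..<M} - {i - 1}. (h p)\<^sup>2)"
    by (rule sum.remove) (use assms in auto)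
  also have "(\<Sum>p\<in>{..<M} - {i - 1}. (h p)\<^sup>2) = (\<Sum>p\<in>{..<M} - {i - 1}. 1 / (real M * (real M - 1)))"
    by (rule sum.cong) (use assms sq in \<open>auto simp: h_def power_divide\<close>)
  also have "\<dots> = (real M - 1) / (real M * (real M - 1))"
    using c by simp
  also have "(h (i - 1))\<^sup>2 = (real M - 1)\<^sup>2 / (real M * (real M - 1))"
    using assms(1) sq by (simp add: h_def power_divide)
  also have "(real M - 1)\<^sup>2 / (real M * (real M - 1)) + (real M - 1) / (real M * (real M - 1)) = 1"
  proof -
    have "real M - 1 \<noteq> 0" "real M \<noteq> 0" using assms(2) by auto
    then have "(real M - 1)\<^sup>2 / (real M * (real M - 1)) = (real M - 1) / real M"
      "(real M - 1) / (real M * (real M - 1)) = 1 / real M"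
      by (simp_all add: power2_eq_square)
    then show ?thesis using assms(2) by (simp flip: add_divide_distrib)
  qed
  finally show ?thesis .
qed

lemma sum_simplex_vec:
  assumes "2 \<le> M"
  shows "(\<Sum>m\<in>{1..M}. simplex_vec M m :: real^'d::{finite,linorder}) = 0"
proof -
  have "(\<Sum>m\<in>{1..M}. (simplex_vec M m :: (real, 'd) vec) $ j) = 0" for j
  proof (cases "coord_pos j < M")
    case True
    let ?p = "coord_pos j + 1" and ?s = "sqrt (real M * (real M - 1))"
    have p: "?p \<in> {1..M}" using True by auto
    have "(\<Sum>m\<in>{1..M}. (simplex_vec M m :: (real, 'd) vec) $ j)
        = (simplex_vec M ?p :: (real, 'd) vec) $ j + (\<Sum>m\<in>{1..M} - {?p}. (simplex_vec M m :: (real, 'd) vec) $ j)"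
      by (rule sum.remove) (use p in auto)
    also have "(\<Sum>m\<in>{1..M} - {?p}. (simplex_vec M m :: (real, 'd) vec) $ j) = (\<Sum>m\<in>{1..M} - {?p}. - 1 / ?s)"
      by (rule sum.cong) (use True in \<open>auto simp: simplex_vec_def\<close>)
    also have "\<dots> = - ((real M - 1) / ?s)"
      using p assms by (simp add: card_Diff_singleton of_nat_diff flip: minus_divide_left)
    finally show ?thesis by (simp add: simplex_vec_def)
  next
    case False
    then show ?thesis by (intro sum.neutral) (auto simp: simplex_vec_def)
  qed
  then show ?thesis by (simp add: vec_eq_iff)
qed

text \<open>Exchanging two of the first \<open>M\<close> coordinates exchanges the corresponding
  simplex vectors. A transposition of codewords is thus an isometry, and Haar invariance will make
  the codewords exchangeable.\<close>

lemma simplex_swap_matrix: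
  assumes "a \<in> {1..M}" "b \<in> {1..M}" "M \<le> CARD('d::{finite,linorder})"
  obtains P :: "real^'d::{finite,linorder}^'d::{finite,linorder}" where "orthogonal_matrix P"
    "\<And>m. P *v simplex_vec M m = simplex_vec M (Transposition.transpose a b m)"
proof -
  have "a - 1 \<in> range (coord_pos :: 'd \<Rightarrow> nat)" "b - 1 \<in> range (coord_pos :: 'd \<Rightarrow> nat)"
    using bij_betw_imp_surj_on[OF bij_betw_coord_pos[where ?'d = 'd]] assms by auto
  then obtain i j :: 'd where ij: "coord_pos i = a - 1" "coord_pos j = b - 1" by force
  define \<tau> where "\<tau> = Transposition.transpose i j"
  define f :: "(real, 'd) vec \<Rightarrow> (real, 'd) vec" where "f = (\<lambda>x. \<chi> l. x $ \<tau> l)"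
  have inj: "inj (coord_pos :: 'd \<Rightarrow> nat)"
    using bij_betw_coord_pos by (rule bij_betw_imp_inj_on)
  have pos: "coord_pos (\<tau> l) + 1 = Transposition.transpose a b (coord_pos l + 1)" for l
  proof -
    consider "l = i" | "l = j" | "l \<noteq> i" "l \<noteq> j" by blast
    then show ?thesis
    proof cases
      case 3
      then have "coord_pos l \<noteq> a - 1" "coord_pos l \<noteq> b - 1"
        using inj ij by (metis injD)+
      then have "coord_pos l + 1 \<noteq> a" "coord_pos l + 1 \<noteq> b" by auto
      then show ?thesis using 3 by (simp add: \<tau>_def)
    qed (use ij assms in \<open>simp_all add: \<tau>_def\<close>)
  qed
  have range: "coord_pos (\<tau> l) < M \<longleftrightarrow> coord_pos l < M" for l
  proof -
    consider "l = i" | "l = j" | "l \<noteq> i" "l \<noteq> j" by blast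
    then show ?thesis by cases (use ij assms in \<open>auto simp: \<tau>_def\<close>)
  qed
  have lin: "linear f" by (rule linearI) (simp_all add: f_def vec_eq_iff)
  have "f x \<bullet> f y = x \<bullet> y" for x y
    using sum.reindex_bij_betw[of \<tau> UNIV UNIV "\<lambda>l. x $ l * y $ l"]
    by (simp add: f_def inner_vec_def \<tau>_def)
  then have "orthogonal_transformation f" using lin by (simp add: orthogonal_transformation_def)
  moreover have "matrix f *v simplex_vec M m = simplex_vec M (Transposition.transpose a b m)" for m
  proof -
    have "coord_pos (\<tau> l) + 1 = m \<longleftrightarrow> coord_pos l + 1 = Transposition.transpose a b m" for l
      unfolding pos by (metis transpose_involutory)
    then have "f (simplex_vec M m) = simplex_vec M (Transposition.transpose a b m)"
      by (simp add: f_def simplex_vec_def vec_eq_iff range)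
    then show ?thesis using lin by (simp add: matrix_vector_mul(2))
  qed
  ultimately show ?thesis
    using that orthogonal_transformation_matrix by blast
qed

subsection \<open>Rounding to a finite net\<close>

lemma finite_net_projection:
  fixes K :: "'a::euclidean_space set"
  assumes "compact K" "K \<noteq> {}" "0 < \<delta>"
  obtains F \<pi> where "finite F" "F \<noteq> {}" "F \<subseteq> K" "\<pi> \<in> measurable borel (count_space F)"
    "\<And>w. w \<in> K \<Longrightarrow> dist (\<pi> w) w < \<delta>"
proof -
  obtain F where F: "finite F" "F \<subseteq> K" "K \<subseteq> (\<Union>y\<in>F. ball y \<delta>)"
  proof (rule compactE_image[OF assms(1), of K "\<lambda>y. ball y \<delta>"])
    show "K \<subseteq> (\<Union>y\<in>K. ball y \<delta>)" using assms(3) by auto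
  qed auto
  obtain f and n :: nat where f: "F = f ` {i. i < n}"
    using finite_imp_nat_seg_image_inj_on[OF F(1)] by metis
  have n: "0 < n" using F(3) assms(2) unfolding f by (cases n) auto
  \<comment> \<open>The first net point close to \<open>w\<close> is chosen, which is a measurable
    choice. The alternative \<open>i = n\<close> keeps \<open>LEAST\<close> well defined for points
    far from the net; \<open>\<pi>\<close> sends those to the default \<open>f 0\<close>.\<close>
  define g where "g w = (LEAST i. i < n \<and> dist (f i) w < \<delta> \<or> i = n)" for w
  define \<pi> where "\<pi> w = (if g w < n then f (g w) else f 0)" for w
  have [measurable]: "g \<in> measurable borel (count_space UNIV)"
    unfolding g_def by measurable
  have "\<pi> \<in> measurable borel (count_space UNIV)"
    unfolding \<pi>_def by measurable
  moreover have "\<pi> w \<in> F" for w unfolding \<pi>_def f using n by simp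
  ultimately have "\<pi> \<in> measurable borel (count_space F)"
    by (auto simp: measurable_def)
  moreover have "dist (\<pi> w) w < \<delta>" if w: "w \<in> K" for w
  proof -
    obtain i where i: "i < n" "dist (f i) w < \<delta>" using F(3) w unfolding f by auto
    let ?P = "\<lambda>i. i < n \<and> dist (f i) w < \<delta> \<or> i = n"
    have "g w \<le> i" unfolding g_def by (rule Least_le) (use i in simp)
    moreover have "?P (g w)" unfolding g_def by (rule LeastI[of ?P i]) (use i in simp)
    ultimately show ?thesis using i(1) unfolding \<pi>_def by auto
  qed
  ultimately show ?thesis using that[OF F(1) _ F(2), of \<pi>] F(3) assms(2) by blast
qed

subsection \<open>Gains of allocations under Haar measure\<close>

locale simplex_haar = haar_measure \<mu>
  for \<mu> :: "(real^'d::{finite,linorder}^'d::{finite,linorder}) measure" +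
  fixes M :: nat and \<epsilon> :: real and e :: "real^'d::{finite,linorder}"
  assumes M_ge: "2 \<le> M" and M_le: "M \<le> CARD('d)" and eps: "0 < \<epsilon>" and norm_e: "norm e = 1"
begin

abbreviation s :: "nat \<Rightarrow> real^'d::{finite,linorder}" where "s \<equiv> simplex_vec M"

text \<open>The rotation acts on the input instead of the codebook: \<open>A *v e\<close> is a
  random point of the sphere while the simplex stays fixed. \<open>integral_apply_sphere\<close>
  relates this picture to a rotated codebook with an arbitrary fixed unit input.\<close>

definition X :: "real^'d::{finite,linorder}^'d::{finite,linorder} \<Rightarrow> nat \<Rightarrow> real" where
  "X A m = s m \<bullet> (A *v e)"

text \<open>At scale \<open>r\<close> the decoded vector of the \<open>k\<close>-closest encoding
  has mean \<open>(r * gain k) *\<^sub>R v\<close>, as shown in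
  \<open>integral_k_closest\<close>.\<close>

definition gain :: "nat \<Rightarrow> real" where
  "gain k = (\<integral>A. top_value \<epsilon> M k (X A) \<partial>\<mu>)"

definition mean_stat :: "nat \<Rightarrow> real" where
  "mean_stat i = (\<integral>A. order_stat M (X A) i \<partial>\<mu>)"

definition mean_tilt :: "nat \<Rightarrow> nat \<Rightarrow> real" where
  "mean_tilt i m = (\<integral>A. tilt \<epsilon> (X A m - order_stat M (X A) i) \<partial>\<mu>)"

lemma norm_s: "m \<in> {1..M} \<Longrightarrow> norm (s m) = 1"
  using inner_simplex_vec_self[OF _ M_ge M_le] by (simp add: norm_eq_sqrt_inner)

lemma norm_orthogonal_e: "orthogonal_matrix A \<Longrightarrow> norm (A *v e) = 1"
  by (simp add: norm_orthogonal_matrix norm_e)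

lemma borel_measurable_X [measurable]: "(\<lambda>A. X A m) \<in> borel_measurable borel"
  unfolding X_def by measurable

lemma abs_X_le:
  assumes "orthogonal_matrix A" "m \<in> {1..M}"
  shows "\<bar>X A m\<bar> \<le> 1"
  using Cauchy_Schwarz_ineq2[of "s m" "A *v e"] norm_s[OF assms(2)] norm_orthogonal_e[OF assms(1)]
  by (simp add: X_def)

lemma integrable_bounded:
  fixes f :: "_ \<Rightarrow> 'b::{banach, second_countable_topology}"
  assumes "f \<in> borel_measurable borel" "\<And>A. orthogonal_matrix A \<Longrightarrow> norm (f A) \<le> c"
  shows "integrable \<mu> f"
proof (rule integrable_const_bound)
  show "AE A in \<mu>. norm (f A) \<le> c"
    using AE_orthogonal by eventually_elim (rule assms(2))
  show "f \<in> borel_measurable \<mu>" using assms(1) by measurable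
qed

lemma integrable_order_stat:
  assumes "i < M"
  shows "integrable \<mu> (\<lambda>A. order_stat M (X A) i)"
proof (rule integrable_bounded)
  show "(\<lambda>A. order_stat M (X A) i) \<in> borel_measurable borel"
    by (rule borel_measurable_order_stat[OF assms]) measurable
  show "norm (order_stat M (X A) i) \<le> 1" if "orthogonal_matrix A" for A
    unfolding real_norm_def by (rule order_stat_abs_le[OF assms]) (rule abs_X_le[OF that])
qed

lemma integrable_tilt:
  assumes "i < M" "m \<in> {1..M}"
  shows "integrable \<mu> (\<lambda>A. tilt \<epsilon> (X A m - order_stat M (X A) i))"
proof (rule integrable_bounded)
  have [measurable]: "(\<lambda>A. order_stat M (X A) i) \<in> borel_measurable borel"
    by (rule borel_measurable_order_stat[OF assms(1)]) measurable
  show "(\<lambda>A. tilt \<epsilon> (X A m - order_stat M (X A) i)) \<in> borel_measurable borel"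
    by measurable
  show "norm (tilt \<epsilon> (X A m - order_stat M (X A) i)) \<le> exp \<epsilon> * 2" if A: "orthogonal_matrix A" for A
  proof -
    have "\<bar>order_stat M (X A) i\<bar> \<le> 1"
      by (rule order_stat_abs_le[OF assms(1)]) (rule abs_X_le[OF A])
    then have "\<bar>X A m - order_stat M (X A) i\<bar> \<le> 2"
      using abs_X_le[OF A assms(2)] by linarith
    then have "exp \<epsilon> * \<bar>X A m - order_stat M (X A) i\<bar> \<le> exp \<epsilon> * 2" by simp
    with abs_tilt_le[OF eps, of "X A m - order_stat M (X A) i"] show ?thesis
      unfolding real_norm_def by (rule order_trans)
  qed
qed

text \<open>Left multiplication by the transpose of a swap matrix permutes the entries of
  \<open>X A\<close> and preserves Haar measure, while the order statistic is unaffected by the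
  permutation.\<close>

lemma mean_tilt_eq:
  assumes "i < M" "a \<in> {1..M}" "b \<in> {1..M}"
  shows "mean_tilt i a = mean_tilt i b"
proof -
  obtain P :: "((real, 'd) vec, 'd) vec" where P: "orthogonal_matrix P"
    "\<And>m. P *v s m = s (Transposition.transpose a b m)"
    using simplex_swap_matrix[OF assms(2,3) M_le] by metis
  have X: "X (transpose P ** A) = (\<lambda>m. X A (Transposition.transpose a b m))" for A
    by (simp add: X_def fun_eq_iff inner_transpose P(2) del: transpose_matrix_vector
        flip: matrix_vector_mul_assoc)
  have "bij_betw (Transposition.transpose a b) {1..M} {1..M}"
    using assms(2,3) by (simp add: bij_betw_transpose_iff)
  then have stat: "order_stat M (X (transpose P ** A)) i = order_stat M (X A) i" for A
    unfolding X by (rule order_stat_permute[OF assms(1)])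
  have [measurable]: "(\<lambda>A. order_stat M (X A) i) \<in> borel_measurable borel"
    by (rule borel_measurable_order_stat[OF assms(1)]) measurable
  have "mean_tilt i a
      = (\<integral>A. tilt \<epsilon> (X (transpose P ** A) a - order_stat M (X (transpose P ** A)) i) \<partial>\<mu>)"
    unfolding mean_tilt_def
    by (rule integral_left_mult[symmetric,
          where f = "\<lambda>A. tilt \<epsilon> (X A a - order_stat M (X A) i)"]) (use P(1) in simp_all)
  also have "\<dots> = mean_tilt i b"
    unfolding stat unfolding X mean_tilt_def by simp
  finally show ?thesis .
qed

text \<open>By exchangeability all \<open>mean_tilt i m\<close> coincide, so the floor
  \<open>p\<close> enters only through its total mass.\<close>

lemma integral_threshold:
  assumes "i < M"
  shows "(\<integral>A. order_stat M (X A) i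
      + (\<Sum>m\<in>{1..M}. p m * tilt \<epsilon> (X A m - order_stat M (X A) i)) \<partial>\<mu>)
    = mean_stat i + (\<Sum>m\<in>{1..M}. p m) * mean_tilt i 1"
proof -
  have "(\<integral>A. order_stat M (X A) i
      + (\<Sum>m\<in>{1..M}. p m * tilt \<epsilon> (X A m - order_stat M (X A) i)) \<partial>\<mu>)
    = mean_stat i + (\<Sum>m\<in>{1..M}. p m * mean_tilt i m)"
    unfolding mean_stat_def mean_tilt_def
    by (subst Bochner_Integration.integral_add)
      (intro integrable_order_stat[OF assms] Bochner_Integration.integrable_sum
        integrable_mult_right integrable_tilt[OF assms]
       | simp add: integrable_tilt[OF assms] del: atLeastAtMost_iff)+
  also have "(\<Sum>m\<in>{1..M}. p m * mean_tilt i m) = (\<Sum>m\<in>{1..M}. p m * mean_tilt i 1)"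
    using M_ge by (intro sum.cong refl arg_cong2[where f = times] mean_tilt_eq[OF assms]) auto
  finally show ?thesis by (simp add: sum_distrib_right)
qed

text \<open>The top-weight allocation has the constant floor
  \<open>1 / total_weight \<epsilon> M k\<close>, of total mass
  \<open>M / total_weight \<epsilon> M k\<close>.\<close>

lemma gain_eq:
  assumes "i < M" "k = i \<or> k = Suc i"
  shows "gain k = mean_stat i + real M / total_weight \<epsilon> M k * mean_tilt i 1"
  using integral_threshold[OF assms(1), of "\<lambda>m. 1 / total_weight \<epsilon> M k"]
  by (simp add: gain_def top_value_eq_threshold[OF assms] sum_divide_distrib)

text \<open>The dual bound is affine in the total floor mass \<open>\<Sum>m. p m\<close>, and at the masses
  \<open>M / total_weight \<epsilon> M k\<close> with \<open>k\<close> one of the two neighbours of the threshold index it is \<open>gain k\<close>.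
  This is why some integer \<open>k\<close> is optimal.\<close>

lemma integral_ldp_le:
  assumes A: "orthogonal_matrix A" and F: "finite F" "F \<noteq> {}"
    and \<pi> [measurable]: "\<pi> \<in> measurable borel (count_space F)"
    and nonneg: "\<And>y m. y \<in> F \<Longrightarrow> m \<in> {1..M} \<Longrightarrow> 0 \<le> q y m"
    and sum1: "\<And>y. y \<in> F \<Longrightarrow> (\<Sum>m\<in>{1..M}. q y m) = 1"
    and ldp: "\<And>y y' m. y \<in> F \<Longrightarrow> y' \<in> F \<Longrightarrow> m \<in> {1..M} \<Longrightarrow> q y m \<le> exp \<epsilon> * q y' m"
    and C: "\<And>k. k \<le> M \<Longrightarrow> gain k \<le> C"
  shows "(\<integral>B. (\<Sum>m\<in>{1..M}. q (\<pi> B) m * ((A *v s m) \<bullet> (B *v e))) \<partial>\<mu>) \<le> C"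
proof -
  \<comment> \<open>The floor is the least probability of \<open>m\<close> over the net. By the
    privacy constraint every \<open>q y m\<close> then lies between \<open>p m\<close> and
    \<open>exp \<epsilon> * p m\<close>.\<close>
  define p where "p m = Min ((\<lambda>y. q y m) ` F)" for m
  have p_le: "p m \<le> q y m" if "y \<in> F" for y m
    unfolding p_def using F that by (intro Min_le) auto
  have p_ge: "q y m \<le> exp \<epsilon> * p m" if "y \<in> F" "m \<in> {1..M}" for y m
  proof -
    have "p m \<in> (\<lambda>y. q y m) ` F" unfolding p_def using F by (intro Min_in) auto
    then show ?thesis using ldp that by auto
  qed
  define T where "T = (\<Sum>m\<in>{1..M}. p m)"
  obtain y where y: "y \<in> F" using F by blast
  have T_le: "T \<le> 1"
    unfolding T_def sum1[OF y, symmetric] by (intro sum_mono p_le y)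
  have T_ge: "1 \<le> exp \<epsilon> * T"
    unfolding T_def sum1[OF y, symmetric] sum_distrib_left by (intro sum_mono p_ge y)
  then have T_pos: "0 < T" by (smt (verit) exp_gt_zero zero_less_mult_pos)
  have M_pos: "0 < M" using M_ge by simp
  \<comment> \<open>From \<open>T \<le> 1 \<le> exp \<epsilon> * T\<close> it follows that
    \<open>M / T\<close> lies between \<open>M\<close> and \<open>M * exp \<epsilon>\<close>, the
    total weights for \<open>k = 0\<close> and \<open>k = M\<close>.\<close>
  obtain i where i: "i < M" "total_weight \<epsilon> M i \<le> real M / T"
    "real M / T \<le> total_weight \<epsilon> M (Suc i)"
  proof (rule total_weight_bracket[OF M_pos])
    show "total_weight \<epsilon> M 0 \<le> real M / T"
      using T_le T_pos by (simp add: total_weight_def pos_le_divide_eq mult_left_le)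
    show "real M / T \<le> total_weight \<epsilon> M M"
      using T_ge T_pos mult_left_mono[OF T_ge, of "real M"]
      by (simp add: total_weight_def field_simps)
  qed
  \<comment> \<open>The fixed rotation \<open>A\<close> of the codebook is moved onto the random
    point, where left invariance removes it.\<close>
  let ?x = "\<lambda>B. X (transpose A ** B)"
  let ?f = "\<lambda>B. order_stat M (X B) i + (\<Sum>m\<in>{1..M}. p m * tilt \<epsilon> (X B m - order_stat M (X B) i))"
  have x: "(A *v s m) \<bullet> (B *v e) = ?x B m" for B m
    by (simp add: X_def inner_transpose del: transpose_matrix_vector flip: matrix_vector_mul_assoc)
  have [measurable]: "(\<lambda>A. order_stat M (X A) i) \<in> borel_measurable borel"
    by (rule borel_measurable_order_stat[OF i(1)]) measurable
  have orth: "orthogonal_matrix (transpose A ** B)" if "orthogonal_matrix B" for B :: "((real, 'd) vec, 'd) vec"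
    using A that by (intro orthogonal_matrix_mul) simp_all
  have \<pi>F: "\<pi> B \<in> F" for B using measurable_space[OF \<pi>, of B] by simp
  have meas [measurable]: "(\<lambda>B. q (\<pi> B) m) \<in> borel_measurable borel" for m
    by (rule measurable_compose[OF \<pi>]) simp
  have q_le: "\<bar>q y m\<bar> \<le> 1" if "y \<in> F" "m \<in> {1..M}" for y m
    using nonneg[OF that] sum1[OF that(1)] member_le_sum[of m "{1..M}" "q y"] nonneg[OF that(1)] that
    by auto
  have "(\<integral>B. (\<Sum>m\<in>{1..M}. q (\<pi> B) m * ?x B m) \<partial>\<mu>) \<le> (\<integral>B. ?f (transpose A ** B) \<partial>\<mu>)"
  proof (rule integral_mono)
    show "integrable \<mu> (\<lambda>B. \<Sum>m\<in>{1..M}. q (\<pi> B) m * ?x B m)"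
    proof (intro Bochner_Integration.integrable_sum integrable_bounded)
      fix m B assume m: "m \<in> {1..M}" and "orthogonal_matrix (B :: ((real, 'd) vec, 'd) vec)"
      then show "norm (q (\<pi> B) m * ?x B m) \<le> 1"
        using q_le[OF \<pi>F m, of B] abs_X_le[OF orth m] by (simp add: abs_mult mult_le_one)
    qed measurable
    show "integrable \<mu> (\<lambda>B. ?f (transpose A ** B))"
    proof -
      have "integrable \<mu> ?f"
        by (intro Bochner_Integration.integrable_add Bochner_Integration.integrable_sum
            integrable_mult_right integrable_order_stat[OF i(1)] integrable_tilt[OF i(1)])
      then have "integrable (distr \<mu> borel (\<lambda>B. transpose A ** B)) ?f"
        using A by (simp add: distr_left_mult)
      then show ?thesis by (rule integrable_distr[rotated]) measurable
    qed
    show "(\<Sum>m\<in>{1..M}. q (\<pi> B) m * ?x B m) \<le> ?f (transpose A ** B)" for B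
      by (rule weighted_sum_le_threshold) (use p_le p_ge \<pi>F sum1 in auto)
  qed
  also have "\<dots> = (\<integral>B. ?f B \<partial>\<mu>)"
    by (rule integral_left_mult[where f = ?f]) (use A in simp_all)
  also have "\<dots> = mean_stat i + T * mean_tilt i 1"
    unfolding T_def by (rule integral_threshold[OF i(1)])
  also have "\<dots> \<le> C"
  \<comment> \<open>Reciprocals reverse the bracket: \<open>Suc i\<close> gives the lower endpoint
    for \<open>T\<close> and \<open>i\<close> the upper one.\<close>
  proof (rule affine_le_endpoint_max)
    have pos: "0 < total_weight \<epsilon> M k" if "k \<in> {i, Suc i}" for k
      by (rule total_weight_pos) (use i(1) that in auto)
    show "real M / total_weight \<epsilon> M (Suc i) \<le> T"
      using i(3) T_pos pos[of "Suc i"] by (simp add: pos_divide_le_eq mult.commute)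
    show "T \<le> real M / total_weight \<epsilon> M i"
      using i(2) T_pos pos[of i] by (simp add: pos_le_divide_eq mult.commute)
    show "mean_stat i + real M / total_weight \<epsilon> M (Suc i) * mean_tilt i 1 \<le> C"
      using C[of "Suc i"] gain_eq[OF i(1), of "Suc i"] i(1) by simp
    show "mean_stat i + real M / total_weight \<epsilon> M i * mean_tilt i 1 \<le> C"
      using C[of i] gain_eq[OF i(1), of i] i(1) by simp
  qed
  finally show ?thesis unfolding x .
qed

section \<open>Positivity of the best gain\<close>

lemma sum_X: "(\<Sum>m\<in>{1..M}. X A m) = 0"
proof -
  have "(\<Sum>m\<in>{1..M}. X A m) = (\<Sum>m\<in>{1..M}. s m) \<bullet> (A *v e)"
    by (simp add: X_def inner_sum_left)
  then show ?thesis unfolding sum_simplex_vec[OF M_ge] by simp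
qed

text \<open>By invariance every coordinate of \<open>A *v e\<close> has the same second moment as
  \<open>X A 1\<close>. These moments add up to the squared norm 1, so each equals
  \<open>1 / d\<close>.\<close>

lemma integral_X_square_pos: "0 < (\<integral>A. (X A 1)\<^sup>2 \<partial>\<mu>)"
proof -
  have one: "1 \<in> {1..M}" using M_ge by simp
  have axis: "(\<integral>A. (axis j 1 \<bullet> (A *v e))\<^sup>2 \<partial>\<mu>) = (\<integral>A. (X A 1)\<^sup>2 \<partial>\<mu>)" for j :: 'd
  proof -
    obtain B :: "((real, 'd) vec, 'd) vec" where B: "orthogonal_matrix B" "B *v axis j 1 = s 1"
      using orthogonal_matrix_exists[of "axis j 1 :: (real, 'd) vec" "s 1"] norm_s[OF one] by auto
    have "X A 1 = axis j 1 \<bullet> ((transpose B ** A) *v e)" for A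
      unfolding X_def B(2)[symmetric]
      by (simp add: inner_transpose del: transpose_matrix_vector flip: matrix_vector_mul_assoc)
    then show ?thesis
      using integral_left_mult[of "transpose B" "\<lambda>A. (axis j 1 \<bullet> (A *v e))\<^sup>2"] B(1) by simp
  qed
  have int: "integrable \<mu> (\<lambda>A. (axis j 1 \<bullet> (A *v e))\<^sup>2)" for j :: 'd
  proof (rule integrable_bounded)
    fix A :: "((real, 'd) vec, 'd) vec" assume "orthogonal_matrix A"
    then show "norm ((axis j 1 \<bullet> (A *v e))\<^sup>2) \<le> 1"
      using Cauchy_Schwarz_ineq2[of "axis j 1" "A *v e"] norm_orthogonal_e
      by (simp add: abs_square_le_1)
  qed measurable
  have "(\<Sum>j\<in>(UNIV::'d set). (\<integral>A. (axis j 1 \<bullet> (A *v e))\<^sup>2 \<partial>\<mu>))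
      = (\<integral>A. (\<Sum>j\<in>(UNIV::'d set). (axis j 1 \<bullet> (A *v e))\<^sup>2) \<partial>\<mu>)"
    by (rule Bochner_Integration.integral_sum[symmetric]) (rule int)
  also have "\<dots> = (\<integral>A. 1 \<partial>\<mu>)"
  proof (rule integral_cong_AE)
    show "AE A in \<mu>. (\<Sum>j\<in>(UNIV::'d set). (axis j 1 \<bullet> (A *v e))\<^sup>2) = 1"
      using AE_orthogonal
    proof eventually_elim
      fix A :: "((real, 'd) vec, 'd) vec" assume "orthogonal_matrix A"
      then have "(A *v e) \<bullet> (A *v e) = 1"
        using norm_orthogonal_e[of A] by (simp add: norm_eq_1)
      moreover have "axis j 1 \<bullet> (A *v e) = (A *v e) $ j" for j
        by (simp add: inner_axis')
      ultimately show "(\<Sum>j\<in>UNIV. (axis j 1 \<bullet> (A *v e))\<^sup>2) = 1"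
        by (simp only: inner_vec_def power2_eq_square inner_real_def)
    qed
  qed measurable
  finally have "real CARD('d) * (\<integral>A. (X A 1)\<^sup>2 \<partial>\<mu>) = 1"
    by (simp add: axis)
  then show ?thesis by (smt (verit) of_nat_0_le_iff mult_nonneg_nonpos)
qed

text \<open>The scale \<open>1 / gain k\<close> makes sense only if some gain is positive. For
  \<open>k = 1\<close> the zero sum of the entries makes the value a positive multiple of the
  largest entry. The zero sum also forces that entry to be at least
  \<open>\<bar>X A 1\<bar> / M\<close>, hence at least \<open>(X A 1)\<^sup>2 / M\<close>, which has
  positive mean.\<close>

lemma gain_1_pos: "0 < gain 1"
proof -
  have M: "0 < M" "(1::nat) \<le> M" using M_ge by auto
  \<comment> \<open>As \<open>total_weight \<epsilon> M 1 - M = exp \<epsilon> - 1\<close>, the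
    largest entry carries the factor
    \<open>(exp \<epsilon> - 1) / total_weight \<epsilon> M 1\<close>. The extra
    \<open>1 / M\<close> pays for comparing that entry with \<open>X A 1\<close>.\<close>
  define c where "c = (exp \<epsilon> - 1) / (total_weight \<epsilon> M 1 * real M)"
  have c: "0 < c" using eps total_weight_pos[OF M, of \<epsilon>] M by (simp add: c_def)
  have tv: "top_value \<epsilon> M 1 (X A) = order_stat M (X A) 0
      + (\<Sum>m\<in>{1..M}. tilt \<epsilon> (X A m - order_stat M (X A) 0)) / total_weight \<epsilon> M 1" for A
    by (rule top_value_eq_threshold[OF M(1)]) simp
  have ge: "c * (X A 1)\<^sup>2 \<le> top_value \<epsilon> M 1 (X A)" if A: "orthogonal_matrix A" for A
  proof -
    let ?l = "order_stat M (X A) 0"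
    have le: "X A m \<le> ?l" if "m \<in> {1..M}" for m
      by (rule le_order_stat[OF M(1) that]) simp
    have "tilt \<epsilon> (X A m - ?l) = X A m - ?l" if "m \<in> {1..M}" for m
      using le[OF that] by (auto simp: tilt_def)
    then have "(\<Sum>m\<in>{1..M}. tilt \<epsilon> (X A m - ?l)) = - real M * ?l"
      using sum_X[of A] by (simp add: sum_subtractf)
    then have "top_value \<epsilon> M 1 (X A) = ?l - real M * ?l / total_weight \<epsilon> M 1"
      unfolding tv by simp
    also have "\<dots> = (total_weight \<epsilon> M 1 - real M) / total_weight \<epsilon> M 1 * ?l"
      using total_weight_pos[OF M, of \<epsilon>] by (simp add: field_simps)
    also have "\<dots> = c * (real M * ?l)"
      using M by (simp add: c_def total_weight_def)
    finally have eq: "top_value \<epsilon> M 1 (X A) = c * (real M * ?l)" .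
    have "(\<Sum>m\<in>{1..M}. X A m) \<le> (\<Sum>m\<in>{1..M}. ?l)" by (rule sum_mono) (rule le)
    then have "0 \<le> real M * ?l" using sum_X[of A] by simp
    then have l: "0 \<le> ?l" using M by (simp add: zero_le_mult_iff)
    have one: "1 \<in> {1..M}" using M by simp
    have "- X A 1 = (\<Sum>m\<in>{1..M} - {1}. X A m)"
      using sum_X[of A] sum.remove[OF _ one, of "X A"] by simp
    also have "\<dots> \<le> (\<Sum>m\<in>{1..M} - {1}. ?l)" by (rule sum_mono) (use le in blast)
    also have "\<dots> \<le> real M * ?l" using l M by (simp add: mult_right_mono)
    finally have "- X A 1 \<le> real M * ?l" .
    moreover have "X A 1 \<le> real M * ?l"
      using le[OF one] mult_right_mono[of 1 "real M" ?l] l M by simp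
    ultimately have "\<bar>X A 1\<bar> \<le> real M * ?l" by linarith
    moreover have "(X A 1)\<^sup>2 \<le> \<bar>X A 1\<bar>"
      using abs_X_le[OF A one] mult_left_le[of "\<bar>X A 1\<bar>" "\<bar>X A 1\<bar>"]
      by (simp add: power2_eq_square)
    ultimately show ?thesis unfolding eq using c by (intro mult_left_mono) auto
  qed
  have "c * (\<integral>A. (X A 1)\<^sup>2 \<partial>\<mu>) = (\<integral>A. c * (X A 1)\<^sup>2 \<partial>\<mu>)" by simp
  also have "\<dots> \<le> gain 1"
    unfolding gain_def
  proof (rule integral_mono_AE)
    show "integrable \<mu> (\<lambda>A. c * (X A 1)\<^sup>2)"
    proof (intro integrable_mult_right integrable_bounded)
      fix A :: "((real, 'd) vec, 'd) vec" assume "orthogonal_matrix A"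
      then show "norm ((X A 1)\<^sup>2) \<le> 1"
        using abs_X_le[of A 1] M by (simp add: abs_square_le_1)
    qed measurable
    show "integrable \<mu> (\<lambda>A. top_value \<epsilon> M 1 (X A))"
      unfolding tv
      by (intro Bochner_Integration.integrable_add integrable_divide
          Bochner_Integration.integrable_sum integrable_order_stat[OF M(1)] integrable_tilt[OF M(1)])
    show "AE A in \<mu>. c * (X A 1)\<^sup>2 \<le> top_value \<epsilon> M 1 (X A)"
      using AE_orthogonal by eventually_elim (rule ge)
  qed
  finally show ?thesis using c integral_X_square_pos by (meson less_le_trans mult_pos_pos)
qed

section \<open>Unbiased encoders: their error and a lower bound on their scale\<close>

lemma simplex_codebook_eq:
  fixes A :: "real^'d::{finite,linorder}^'d::{finite,linorder}"
  shows "simplex_codebook M r A m = r *\<^sub>R (A *v s m)"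
  by (simp add: simplex_codebook_def)

lemma norm_simplex_codebook:
  fixes A :: "real^'d::{finite,linorder}^'d::{finite,linorder}"
  assumes "orthogonal_matrix A" "m \<in> {1..M}" "0 < r"
  shows "norm (simplex_codebook M r A m) = r"
  using assms by (simp add: simplex_codebook_eq norm_orthogonal_matrix norm_s)

lemma borel_measurable_simplex_codebook [measurable (raw)]:
  fixes f :: "'a \<Rightarrow> real^'d::{finite,linorder}^'d::{finite,linorder}"
  assumes [measurable]: "f \<in> borel_measurable N"
  shows "(\<lambda>a. simplex_codebook M r (f a) m) \<in> borel_measurable N"
  unfolding simplex_codebook_eq by measurable

text \<open>The Bochner integral of a non-integrable function is 0 by convention, and 0 is not a
  unit vector; unbiasedness therefore already contains integrability.\<close>

lemma integrable_decoded:
  assumes "is_unbiased \<mu> U M Q" "norm v = 1"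
  shows "integrable \<mu> (\<lambda>A. \<Sum>m\<in>{1..M}. Q v (U A) m *\<^sub>R U A m)"
proof (rule ccontr)
  assume "\<not> ?thesis"
  then have "(\<integral>A. (\<Sum>m\<in>{1..M}. Q v (U A) m *\<^sub>R U A m) \<partial>\<mu>) = 0"
    by (rule not_integrable_integral_eq)
  moreover have "(\<integral>A. (\<Sum>m\<in>{1..M}. Q v (U A) m *\<^sub>R U A m) \<partial>\<mu>) = v"
    using assms unfolding is_unbiased_def by simp
  ultimately show False using assms(2) by simp
qed

lemma worst_err_eq:
  assumes "0 < r" "random_encoder \<mu> (simplex_codebook M r) M Q"
    and unb: "is_unbiased \<mu> (simplex_codebook M r) M Q"
  shows "worst_err \<mu> (simplex_codebook M r) M Q = r\<^sup>2 - 1"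
proof -
  let ?U = "simplex_codebook M r"
  have "(\<integral>A. (\<Sum>m\<in>{1..M}. (norm (?U A m - v))\<^sup>2 * Q v (?U A) m) \<partial>\<mu>) = r\<^sup>2 - 1"
    if v: "v \<in> sphere 0 1" for v
  proof -
    have nv: "norm v = 1" using v by simp
    have [measurable]: "(\<lambda>A. Q v (?U A) m) \<in> borel_measurable \<mu>" if "m \<in> {1..M}" for m
      using assms(2) v that by (simp add: random_encoder_def)
    have Q1: "(\<Sum>m\<in>{1..M}. Q v u m) = 1" for u
      using assms(2) v by (simp add: random_encoder_def)
    have expand: "(r\<^sup>2 + 1 - 2 * t) * q = (r\<^sup>2 + 1) * q - 2 * (q * t)" for t q
      by (simp add: algebra_simps)
    let ?D = "\<lambda>A. \<Sum>m\<in>{1..M}. Q v (?U A) m *\<^sub>R ?U A m"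
    have "(\<integral>A. (\<Sum>m\<in>{1..M}. (norm (?U A m - v))\<^sup>2 * Q v (?U A) m) \<partial>\<mu>)
        = (\<integral>A. r\<^sup>2 + 1 - 2 * (?D A \<bullet> v) \<partial>\<mu>)"
    proof (rule integral_cong_AE)
      show "AE A in \<mu>. (\<Sum>m\<in>{1..M}. (norm (?U A m - v))\<^sup>2 * Q v (?U A) m) = r\<^sup>2 + 1 - 2 * (?D A \<bullet> v)"
        using AE_orthogonal
      proof eventually_elim
        fix A :: "((real, 'd) vec, 'd) vec" assume A: "orthogonal_matrix A"
        have "(\<Sum>m\<in>{1..M}. (norm (?U A m - v))\<^sup>2 * Q v (?U A) m)
            = (\<Sum>m\<in>{1..M}. (r\<^sup>2 + 1) * Q v (?U A) m - 2 * (Q v (?U A) m * (?U A m \<bullet> v)))"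
        proof (rule sum.cong)
          fix m assume m: "m \<in> {1..M}"
          have "(norm (?U A m - v))\<^sup>2 = r\<^sup>2 + 1 - 2 * (?U A m \<bullet> v)"
            using dot_norm_neg[of "?U A m" v] norm_simplex_codebook[OF A m assms(1)] nv
            by (simp add: field_simps)
          then show "(norm (?U A m - v))\<^sup>2 * Q v (?U A) m
              = (r\<^sup>2 + 1) * Q v (?U A) m - 2 * (Q v (?U A) m * (?U A m \<bullet> v))"
            by (simp only: expand)
        qed simp
        also have "\<dots> = (r\<^sup>2 + 1) * (\<Sum>m\<in>{1..M}. Q v (?U A) m) - 2 * (?D A \<bullet> v)"
          by (simp add: sum_subtractf inner_sum_left flip: sum_distrib_left)
        finally show "(\<Sum>m\<in>{1..M}. (norm (?U A m - v))\<^sup>2 * Q v (?U A) m) = r\<^sup>2 + 1 - 2 * (?D A \<bullet> v)"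
          unfolding Q1 by simp
      qed
    qed measurable
    also have "\<dots> = r\<^sup>2 + 1 - 2 * ((\<integral>A. ?D A \<partial>\<mu>) \<bullet> v)"
      using integrable_decoded[OF unb nv] by simp
    also have "(\<integral>A. ?D A \<partial>\<mu>) = v" using unb v by (simp add: is_unbiased_def)
    finally show ?thesis using nv by (simp add: norm_eq_1)
  qed
  \<comment> \<open>The error is the same at every input; \<open>e\<close> shows that the supremum
    of this constant is over a nonempty set.\<close>
  moreover have "e \<in> sphere 0 1" using norm_e by simp
  ultimately show ?thesis
    unfolding worst_err_def by (subst SUP_cong[OF refl]) (auto intro!: cSUP_const)
qed

text \<open>Since \<open>\<pi>\<close> takes finitely many values, the integral splits over its
  cells into a finite sum, linear in the vectors \<open>a y\<close>. Linearity allows these to be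
  replaced by random vectors and averaged.\<close>

lemma integral_finite_range:
  fixes a :: "'b \<Rightarrow> real^'d::{finite,linorder}"
  assumes F: "finite F" and \<pi>: "\<pi> \<in> measurable borel (count_space F)"
  shows "(\<integral>B. a (\<pi> B) \<bullet> (B *v e) \<partial>\<mu>)
    = (\<Sum>y\<in>F. a y \<bullet> (\<integral>B. indicator (\<pi> -` {y}) B *\<^sub>R (B *v e) \<partial>\<mu>))"
proof -
  have int: "integrable \<mu> (\<lambda>B. indicator (\<pi> -` {y}) B *\<^sub>R (B *v e))" if y: "y \<in> F" for y
  proof (rule integrable_bounded)
    have [measurable]: "\<pi> -` {y} \<in> sets borel"
      using measurable_sets[OF \<pi>, of "{y}"] y by simp
    show "(\<lambda>B. indicator (\<pi> -` {y}) B *\<^sub>R (B *v e)) \<in> borel_measurable borel" by measurable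
    show "norm (indicator (\<pi> -` {y}) B *\<^sub>R (B *v e)) \<le> 1" if "orthogonal_matrix B" for B
      using norm_orthogonal_e[OF that] by (simp add: indicator_def)
  qed
  have "a (\<pi> B) \<bullet> (B *v e) = (\<Sum>y\<in>F. a y \<bullet> (indicator (\<pi> -` {y}) B *\<^sub>R (B *v e)))" for B
  proof -
    have "\<pi> B \<in> F" using measurable_space[OF \<pi>, of B] by simp
    then have "a (\<pi> B) \<bullet> (B *v e) = (\<Sum>y\<in>F. if y = \<pi> B then a y \<bullet> (B *v e) else 0)"
      using F by simp
    also have "\<dots> = (\<Sum>y\<in>F. a y \<bullet> (indicator (\<pi> -` {y}) B *\<^sub>R (B *v e)))"
      by (rule sum.cong) (auto simp: indicator_def)
    finally show ?thesis .
  qed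
  then have "(\<integral>B. a (\<pi> B) \<bullet> (B *v e) \<partial>\<mu>)
      = (\<integral>B. (\<Sum>y\<in>F. a y \<bullet> (indicator (\<pi> -` {y}) B *\<^sub>R (B *v e))) \<partial>\<mu>)"
    by simp
  also have "\<dots> = (\<Sum>y\<in>F. \<integral>B. a y \<bullet> (indicator (\<pi> -` {y}) B *\<^sub>R (B *v e)) \<partial>\<mu>)"
    by (rule Bochner_Integration.integral_sum) (intro integrable_inner_right int)
  also have "\<dots> = (\<Sum>y\<in>F. a y \<bullet> (\<integral>B. indicator (\<pi> -` {y}) B *\<^sub>R (B *v e) \<partial>\<mu>))"
    by (intro sum.cong refl integral_inner_right int)
  finally show ?thesis .
qed

text \<open>An encoder need not be measurable in its input \<open>v\<close>, so averaging over the sphere is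
  replaced by rounding the random point \<open>B *v e\<close> to a finite net; only finite sums are
  then interchanged with the integral over the codebook.\<close>

lemma unbiased_ldp_scale_ge:
  assumes r: "0 < r" and enc: "random_encoder \<mu> (simplex_codebook M r) M Q"
    and unb: "is_unbiased \<mu> (simplex_codebook M r) M Q"
    and ldp: "is_ldp \<mu> (simplex_codebook M r) M \<epsilon> Q"
    and C: "\<And>k. k \<le> M \<Longrightarrow> gain k \<le> C"
  shows "1 \<le> r * C"
proof (rule field_le_epsilon)
  fix \<delta> :: real assume \<delta>: "0 < \<delta>"
  let ?U = "simplex_codebook M r"
  have e: "e \<in> sphere 0 1" using norm_e by simp
  then have "sphere (0 :: (real, 'd) vec) 1 \<noteq> {}" by blast
  then obtain F :: "(real, 'd) vec set" and \<pi>0 where F: "finite F" "F \<noteq> {}" "F \<subseteq> sphere 0 1"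
    and \<pi>0: "\<pi>0 \<in> measurable borel (count_space F)"
    and near: "\<And>w. w \<in> sphere 0 1 \<Longrightarrow> dist (\<pi>0 w) w < \<delta>"
    using finite_net_projection[OF compact_sphere _ \<delta>] by metis
  define \<pi> where "\<pi> B = \<pi>0 (B *v e)" for B :: "((real, 'd) vec, 'd) vec"
  have "(\<lambda>B :: ((real, 'd) vec, 'd) vec. B *v e) \<in> borel_measurable borel" by measurable
  then have \<pi>: "\<pi> \<in> measurable borel (count_space F)"
    unfolding \<pi>_def by (rule measurable_compose[OF _ \<pi>0])
  then have \<pi>F: "\<pi> B \<in> F" for B using measurable_space[OF \<pi>, of B] by simp
  have borel_\<pi>: "\<pi> \<in> borel_measurable borel"
    using measurable_compose[OF \<pi>, of "\<lambda>y. y" borel] by simp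
  define W where "W y = (\<integral>B. indicator (\<pi> -` {y}) B *\<^sub>R (B *v e) \<partial>\<mu>)" for y
  define D where "D y A = (\<Sum>m\<in>{1..M}. Q y (?U A) m *\<^sub>R ?U A m)" for y A
  have intD: "integrable \<mu> (D y)" if "y \<in> F" for y
    unfolding D_def by (rule integrable_decoded[OF unb]) (use F(3) that in auto)
  have ED: "(\<integral>A. D y A \<partial>\<mu>) = y" if "y \<in> F" for y
    using unb that F(3) unfolding D_def is_unbiased_def by blast
  \<comment> \<open>Rounding a unit vector by less than \<open>\<delta>\<close> lowers its inner
    product with itself by at most \<open>\<delta>\<close>.\<close>
  have "1 - \<delta> \<le> (\<integral>B. \<pi> B \<bullet> (B *v e) \<partial>\<mu>)"
  proof (rule integral_ge_const)
    have le: "\<bar>\<pi> B \<bullet> (B *v e)\<bar> \<le> 1" if "orthogonal_matrix B" for B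
      using Cauchy_Schwarz_ineq2[of "\<pi> B" "B *v e"] norm_orthogonal_e[OF that] \<pi>F[of B] F(3) by auto
    show "integrable \<mu> (\<lambda>B. \<pi> B \<bullet> (B *v e))"
    proof (rule integrable_bounded)
      show "(\<lambda>B. \<pi> B \<bullet> (B *v e)) \<in> borel_measurable borel" using borel_\<pi> by measurable
    qed (use le in simp)
    show "AE B in \<mu>. 1 - \<delta> \<le> \<pi> B \<bullet> (B *v e)"
      using AE_orthogonal
    proof eventually_elim
      fix B :: "((real, 'd) vec, 'd) vec" assume B: "orthogonal_matrix B"
      let ?w = "B *v e"
      have w: "norm ?w = 1" by (rule norm_orthogonal_e[OF B])
      have "(?w - \<pi> B) \<bullet> ?w \<le> norm (?w - \<pi> B) * norm ?w" by (rule norm_cauchy_schwarz)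
      also have "\<dots> \<le> \<delta>"
        using near[of ?w] w by (simp add: \<pi>_def dist_norm norm_minus_commute)
      finally have "(?w - \<pi> B) \<bullet> ?w \<le> \<delta>" .
      moreover have "?w \<bullet> ?w = 1" using w by (simp add: norm_eq_1)
      ultimately show "1 - \<delta> \<le> \<pi> B \<bullet> ?w" by (simp add: inner_diff_left)
    qed
  qed
  also have "\<dots> = (\<Sum>y\<in>F. y \<bullet> W y)"
    unfolding W_def by (rule integral_finite_range[OF F(1) \<pi>, where a = "\<lambda>y. y"])
  \<comment> \<open>Unbiasedness replaces each net point by the mean of its decoded vector.\<close>
  also have "\<dots> = (\<Sum>y\<in>F. (\<integral>A. D y A \<bullet> W y \<partial>\<mu>))"
    by (intro sum.cong refl) (simp add: ED intD)
  also have "\<dots> = (\<integral>A. (\<Sum>y\<in>F. D y A \<bullet> W y) \<partial>\<mu>)"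
    by (rule Bochner_Integration.integral_sum[symmetric]) (intro integrable_inner_left intD)
  also have "\<dots> \<le> r * C"
  proof (rule integral_le_const)
    show "integrable \<mu> (\<lambda>A. \<Sum>y\<in>F. D y A \<bullet> W y)"
      by (intro Bochner_Integration.integrable_sum integrable_inner_left intD)
    show "AE A in \<mu>. (\<Sum>y\<in>F. D y A \<bullet> W y) \<le> r * C"
      using AE_orthogonal ldp[unfolded is_ldp_def]
    proof eventually_elim
      fix A :: "((real, 'd) vec, 'd) vec"
      assume A: "orthogonal_matrix A"
        and Q: "\<forall>v\<in>sphere 0 1. \<forall>v'\<in>sphere 0 1. \<forall>m\<in>{1..M}. Q v (?U A) m \<le> exp \<epsilon> * Q v' (?U A) m"
      let ?q = "\<lambda>y. Q y (?U A)"
      \<comment> \<open>For a fixed codebook the cells are put together again, giving an average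
        over random inputs to which the dual bound applies.\<close>
      have "(\<Sum>y\<in>F. D y A \<bullet> W y) = (\<integral>B. D (\<pi> B) A \<bullet> (B *v e) \<partial>\<mu>)"
        unfolding W_def by (rule integral_finite_range[OF F(1) \<pi>, where a = "\<lambda>y. D y A", symmetric])
      also have "\<dots> = (\<integral>B. r * (\<Sum>m\<in>{1..M}. ?q (\<pi> B) m * ((A *v s m) \<bullet> (B *v e))) \<partial>\<mu>)"
        by (simp add: D_def simplex_codebook_eq inner_sum_left sum_distrib_left mult_ac)
      also have "\<dots> = r * (\<integral>B. (\<Sum>m\<in>{1..M}. ?q (\<pi> B) m * ((A *v s m) \<bullet> (B *v e))) \<partial>\<mu>)"
        by (rule integral_mult_right_zero)
      also have "\<dots> \<le> r * C"
      proof (rule mult_left_mono)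
        show "(\<integral>B. (\<Sum>m\<in>{1..M}. ?q (\<pi> B) m * ((A *v s m) \<bullet> (B *v e))) \<partial>\<mu>) \<le> C"
        proof (rule integral_ldp_le[OF A F(1,2) \<pi> _ _ _ C])
          show "0 \<le> ?q y m" if "y \<in> F" "m \<in> {1..M}" for y m
            using enc that F(3) unfolding random_encoder_def by blast
          show "(\<Sum>m\<in>{1..M}. ?q y m) = 1" if "y \<in> F" for y
            using enc that F(3) unfolding random_encoder_def by blast
          show "?q y m \<le> exp \<epsilon> * ?q y' m" if "y \<in> F" "y' \<in> F" "m \<in> {1..M}" for y y' m
            using Q that F(3) by blast
        qed
      qed (use r in simp)
      finally show "(\<Sum>y\<in>F. D y A \<bullet> W y) \<le> r * C" .
    qed
  qed
  finally show "1 \<le> r * C + \<delta>" by simp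
qed

section \<open>The \<open>k\<close>-closest encoding for integer \<open>k\<close>\<close>

lemma random_encoder_k_closest:
  assumes "k \<le> M"
  shows "random_encoder \<mu> (simplex_codebook M r) M (k_closest \<epsilon> M (real k))"
proof -
  have M: "0 < M" using M_ge by simp
  have "(\<lambda>A. k_closest \<epsilon> M (real k) v (simplex_codebook M r A) m) \<in> borel_measurable \<mu>"
    if "m \<in> {1..M}" for v m
    unfolding k_closest_eq_top_weight[OF that] by measurable
  moreover have "(\<Sum>m\<in>{1..M}. k_closest \<epsilon> M (real k) v u m) = 1" for v :: "(real, 'd) vec" and u
    unfolding sum_top_weight[OF M assms, of \<epsilon> "\<lambda>n. - (norm (v - u n))\<^sup>2", symmetric]
    by (rule sum.cong[OF refl]) (rule k_closest_eq_top_weight)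
  ultimately show ?thesis
    unfolding random_encoder_def
    by (simp add: k_closest_eq_top_weight top_weight_nonneg[OF M assms] del: atLeastAtMost_iff)
qed

lemma is_ldp_k_closest:
  assumes "k \<le> M"
  shows "is_ldp \<mu> (simplex_codebook M r) M \<epsilon> (k_closest \<epsilon> M (real k))"
proof -
  have t: "0 < total_weight \<epsilon> M k" by (rule total_weight_pos) (use M_ge assms in auto)
  have "1 \<le> exp \<epsilon>" "1 \<le> exp \<epsilon> * exp \<epsilon>" using eps by (simp_all flip: exp_add)
  then have "top_weight \<epsilon> M k x m \<le> exp \<epsilon> * top_weight \<epsilon> M k y m" for x y m
    using t by (simp add: top_weight_def divide_right_mono)
  then show ?thesis
    by (simp add: is_ldp_def k_closest_eq_top_weight del: atLeastAtMost_iff)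
qed

text \<open>All codewords have norm \<open>r\<close>, so a smaller distance to \<open>v\<close>
  means a larger inner product with \<open>v\<close>; the positive factor \<open>r\<close> does not
  affect the order.\<close>

lemma k_closest_orthogonal:
  assumes "orthogonal_matrix A" "norm v = 1" "0 < r" "m \<in> {1..M}"
  shows "k_closest \<epsilon> M (real k) v (simplex_codebook M r A) m
    = top_weight \<epsilon> M k (\<lambda>n. s n \<bullet> (transpose A *v v)) m"
proof -
  have "(norm (v - simplex_codebook M r A n))\<^sup>2 = 1 + r\<^sup>2 - 2 * r * (s n \<bullet> (transpose A *v v))"
    if "n \<in> {1..M}" for n
  proof -
    have "(norm (v - simplex_codebook M r A n))\<^sup>2 = 1 + r\<^sup>2 - 2 * (v \<bullet> simplex_codebook M r A n)"
      using dot_norm_neg[of v "simplex_codebook M r A n"]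
        norm_simplex_codebook[OF assms(1) that assms(3)] assms(2)
      by (simp add: field_simps)
    also have "v \<bullet> simplex_codebook M r A n = r * (s n \<bullet> (transpose A *v v))"
      by (simp add: simplex_codebook_eq inner_transpose inner_commute del: transpose_matrix_vector)
    finally show ?thesis by simp
  qed
  then have "desc_rank M (\<lambda>n. - (norm (v - simplex_codebook M r A n))\<^sup>2) m
      = desc_rank M (\<lambda>n. s n \<bullet> (transpose A *v v)) m"
    using assms(3,4) by (intro desc_rank_cong) simp_all
  then show ?thesis unfolding k_closest_eq_top_weight[OF assms(4)] top_weight_def by simp
qed

text \<open>Symmetry about the axis \<open>v\<close> makes the mean a multiple of \<open>v\<close>,
  and pairing with \<open>v\<close> identifies the factor.\<close>

lemma integral_k_closest:
  assumes k: "k \<le> M" and r: "0 < r" and v: "norm v = 1"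
  shows "(\<integral>A. (\<Sum>m\<in>{1..M}. k_closest \<epsilon> M (real k) v (simplex_codebook M r A) m
      *\<^sub>R simplex_codebook M r A m) \<partial>\<mu>) = (r * gain k) *\<^sub>R v"
proof -
  let ?U = "simplex_codebook M r" and ?Q = "k_closest \<epsilon> M (real k)"
  have M: "0 < M" using M_ge by simp
  define D where "D A = (\<Sum>m\<in>{1..M}. ?Q v (?U A) m *\<^sub>R ?U A m)" for A
  have [measurable]: "(\<lambda>A. ?Q v (?U A) m) \<in> borel_measurable borel" if "m \<in> {1..M}" for m
    unfolding k_closest_eq_top_weight[OF that] by measurable
  have [measurable]: "D \<in> borel_measurable borel" unfolding D_def by measurable
  have int: "integrable \<mu> D"
  proof (rule integrable_bounded)
    fix A :: "((real, 'd) vec, 'd) vec" assume A: "orthogonal_matrix A"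
    have "norm (D A) \<le> (\<Sum>m\<in>{1..M}. ?Q v (?U A) m * r)"
      unfolding D_def
    proof (rule sum_norm_le)
      fix m assume m: "m \<in> {1..M}"
      show "norm (?Q v (?U A) m *\<^sub>R ?U A m) \<le> ?Q v (?U A) m * r"
        using top_weight_nonneg[OF M k] norm_simplex_codebook[OF A m r]
        by (simp add: k_closest_eq_top_weight[OF m])
    qed
    also have "\<dots> = r"
      using random_encoder_k_closest[OF k, of r] v
      by (simp add: random_encoder_def flip: sum_distrib_right)
    finally show "norm (D A) \<le> r" .
  qed measurable
  let ?w = "\<integral>A. D A \<partial>\<mu>"
  txt \<open>The mean is fixed by the half-turn \<open>x \<mapsto> 2 (v \<bullet> x) v - x\<close> about \<open>v\<close>, hence parallel to \<open>v\<close>.\<close>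
  define f where "f x = (2 * (v \<bullet> x)) *\<^sub>R v - x" for x
  have lin: "linear f"
    by (rule linearI) (simp_all add: f_def inner_add_right algebra_simps)
  have vv: "v \<bullet> v = 1" using v by (simp add: norm_eq_1)
  then have "f x \<bullet> f y = x \<bullet> y" for x y
    by (simp add: f_def inner_diff_left inner_diff_right inner_commute algebra_simps)
  then have "orthogonal_transformation f" using lin by (simp add: orthogonal_transformation_def)
  then have orth: "orthogonal_matrix (matrix f)" by (simp add: orthogonal_transformation_matrix)
  have mf: "matrix f *v x = f x" for x using lin by (simp add: matrix_vector_mul(2))
  have fv: "f v = v" by (simp add: f_def vv scaleR_2)
  have "norm (f x) = norm x" for x using norm_orthogonal_matrix[OF orth, of x] by (simp add: mf)
  then have dist: "norm (v - f x) = norm (v - x)" for x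
    by (metis fv lin linear_diff)
  have U: "?U (matrix f ** A) m = f (?U A m)" for A m
    using lin by (simp add: simplex_codebook_eq linear_scale mf flip: matrix_vector_mul_assoc)
  \<comment> \<open>An isometry fixing \<open>v\<close> preserves all distances to \<open>v\<close>,
    hence the selection probabilities; only the decoded codewords are rotated.\<close>
  have D: "D (matrix f ** A) = f (D A)" for A
  proof -
    have "?Q v (?U (matrix f ** A)) m = ?Q v (?U A) m" if "m \<in> {1..M}" for m
      unfolding k_closest_eq_top_weight[OF that] U dist ..
    then show ?thesis
      unfolding D_def linear_sum[OF lin] U linear_scale[OF lin] by (intro sum.cong) auto
  qed
  have "?w = (\<integral>A. D (matrix f ** A) \<partial>\<mu>)"
    by (rule integral_left_mult[OF orth, symmetric]) measurable
  also have "\<dots> = f ?w"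
    unfolding D using lin int
    by (intro integral_bounded_linear linear_conv_bounded_linear[THEN iffD1])
  finally have "2 *\<^sub>R ?w = 2 *\<^sub>R ((v \<bullet> ?w) *\<^sub>R v)"
    unfolding f_def by (simp add: scaleR_2 algebra_simps)
  then have par: "?w = (v \<bullet> ?w) *\<^sub>R v" by (rule scaleR_left_imp_eq[where a = 2, rotated]) simp
  have "v \<bullet> ?w = (\<integral>A. v \<bullet> D A \<partial>\<mu>)" using int by simp
  also have "\<dots> = (\<integral>A. r * top_value \<epsilon> M k (\<lambda>n. s n \<bullet> (transpose A *v v)) \<partial>\<mu>)"
  proof (rule integral_cong_AE)
    show "AE A in \<mu>. v \<bullet> D A = r * top_value \<epsilon> M k (\<lambda>n. s n \<bullet> (transpose A *v v))"
      using AE_orthogonal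
    proof eventually_elim
      fix A :: "((real, 'd) vec, 'd) vec" assume A: "orthogonal_matrix A"
      have "v \<bullet> D A = (\<Sum>m\<in>{1..M}. ?Q v (?U A) m * (v \<bullet> ?U A m))"
        by (simp add: D_def inner_sum_right)
      also have "\<dots> = (\<Sum>m\<in>{1..M}. r * (top_weight \<epsilon> M k (\<lambda>n. s n \<bullet> (transpose A *v v)) m
          * (s m \<bullet> (transpose A *v v))))"
      proof (rule sum.cong)
        fix m assume m: "m \<in> {1..M}"
        have "v \<bullet> ?U A m = r * (s m \<bullet> (transpose A *v v))"
          by (simp add: simplex_codebook_eq inner_transpose inner_commute del: transpose_matrix_vector)
        then show "?Q v (?U A) m * (v \<bullet> ?U A m)
            = r * (top_weight \<epsilon> M k (\<lambda>n. s n \<bullet> (transpose A *v v)) m * (s m \<bullet> (transpose A *v v)))"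
          unfolding k_closest_orthogonal[OF A v r m] by simp
      qed simp
      finally show "v \<bullet> D A = r * top_value \<epsilon> M k (\<lambda>n. s n \<bullet> (transpose A *v v))"
        by (simp add: top_value_def sum_distrib_left)
    qed
    show "(\<lambda>A. r * top_value \<epsilon> M k (\<lambda>n. s n \<bullet> (transpose A *v v))) \<in> borel_measurable \<mu>"
      unfolding top_value_def by measurable
  qed measurable
  also have "\<dots> = r * (\<integral>A. top_value \<epsilon> M k (\<lambda>n. s n \<bullet> (transpose A *v v)) \<partial>\<mu>)"
    by (rule integral_mult_right_zero)
  also have "(\<integral>A. top_value \<epsilon> M k (\<lambda>n. s n \<bullet> (transpose A *v v)) \<partial>\<mu>) = gain k"
    unfolding gain_def X_def
  proof (rule integral_apply_sphere[where F = "\<lambda>w. top_value \<epsilon> M k (\<lambda>n. s n \<bullet> w)"])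
    show "(\<lambda>w. top_value \<epsilon> M k (\<lambda>n. s n \<bullet> w)) \<in> borel_measurable borel"
      unfolding top_value_def by measurable
  qed (simp add: v norm_e)
  finally show ?thesis using par by (simp add: D_def)
qed

lemma k_closest_optimal:
  obtains k r where "k \<le> M" "0 < r"
    "random_encoder \<mu> (simplex_codebook M r) M (k_closest \<epsilon> M (real k))"
    "is_unbiased \<mu> (simplex_codebook M r) M (k_closest \<epsilon> M (real k))"
    "is_ldp \<mu> (simplex_codebook M r) M \<epsilon> (k_closest \<epsilon> M (real k))"
    "\<And>r' Q. 0 < r' \<Longrightarrow> random_encoder \<mu> (simplex_codebook M r') M Q
      \<Longrightarrow> is_unbiased \<mu> (simplex_codebook M r') M Q
      \<Longrightarrow> is_ldp \<mu> (simplex_codebook M r') M \<epsilon> Q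
      \<Longrightarrow> worst_err \<mu> (simplex_codebook M r) M (k_closest \<epsilon> M (real k))
        \<le> worst_err \<mu> (simplex_codebook M r') M Q"
proof -
  have "Max (gain ` {..M}) \<in> gain ` {..M}" by (intro Max_in) auto
  then obtain k where k: "k \<le> M" "gain k = Max (gain ` {..M})"
    by (metis atMost_iff imageE)
  have le: "gain j \<le> gain k" if "j \<le> M" for j
    unfolding k(2) using that by (intro Max_ge) auto
  have pos: "0 < gain k" using gain_1_pos le[of 1] M_ge by simp
  \<comment> \<open>At this scale the mean \<open>(r * gain k) *\<^sub>R v\<close> equals
    \<open>v\<close>. Maximality of \<open>gain k\<close> makes it the least scale allowed by
    \<open>unbiased_ldp_scale_ge\<close>, and the error \<open>r\<^sup>2 - 1\<close> increases with
    the scale.\<close>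
  define r where "r = 1 / gain k"
  have r: "0 < r" using pos by (simp add: r_def)
  have enc: "random_encoder \<mu> (simplex_codebook M r) M (k_closest \<epsilon> M (real k))"
    by (rule random_encoder_k_closest[OF k(1)])
  have unb: "is_unbiased \<mu> (simplex_codebook M r) M (k_closest \<epsilon> M (real k))"
    unfolding is_unbiased_def
  proof
    fix v :: "(real, 'd) vec" assume "v \<in> sphere 0 1"
    then show "(\<integral>A. (\<Sum>m\<in>{1..M}. k_closest \<epsilon> M (real k) v (simplex_codebook M r A) m
        *\<^sub>R simplex_codebook M r A m) \<partial>\<mu>) = v"
      using integral_k_closest[OF k(1) r, of v] pos by (simp add: r_def)
  qed
  show ?thesis
  proof (rule that[OF k(1) r enc unb is_ldp_k_closest[OF k(1)]])
    fix r' Q assume r': "0 < r'" and Q: "random_encoder \<mu> (simplex_codebook M r') M Q"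
      "is_unbiased \<mu> (simplex_codebook M r') M Q" "is_ldp \<mu> (simplex_codebook M r') M \<epsilon> Q"
    have "1 \<le> r' * gain k" by (rule unbiased_ldp_scale_ge[OF r' Q le])
    then have "r \<le> r'" using pos by (simp add: r_def pos_divide_le_eq)
    then have "r\<^sup>2 \<le> r'\<^sup>2" using r by (intro power_mono) auto
    then show "worst_err \<mu> (simplex_codebook M r) M (k_closest \<epsilon> M (real k))
        \<le> worst_err \<mu> (simplex_codebook M r') M Q"
      by (simp add: worst_err_eq[OF r enc unb] worst_err_eq[OF r' Q(1,2)])
  qed
qed

end

theorem theorem1:
  fixes \<mu> :: "(real^'d::{finite,linorder}^'d::{finite,linorder}) measure" and b :: nat and \<epsilon> :: real
  assumes "b \<ge> 1" and "2 ^ b < CARD('d)" and "\<epsilon> > 0" and "haar_orthogonal \<mu>"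
  shows "\<exists>k r. 0 \<le> k \<and> k \<le> real (2 ^ b) \<and> r > 0 \<and>
     random_encoder \<mu> (simplex_codebook (2 ^ b) r) (2 ^ b) (k_closest \<epsilon> (2 ^ b) k) \<and>
     is_unbiased \<mu> (simplex_codebook (2 ^ b) r) (2 ^ b) (k_closest \<epsilon> (2 ^ b) k) \<and>
     is_ldp \<mu> (simplex_codebook (2 ^ b) r) (2 ^ b) \<epsilon> (k_closest \<epsilon> (2 ^ b) k) \<and>
     (\<forall>r'>0. \<forall>Q.
        random_encoder \<mu> (simplex_codebook (2 ^ b) r') (2 ^ b) Q \<and>
        is_unbiased \<mu> (simplex_codebook (2 ^ b) r') (2 ^ b) Q \<and>
        is_ldp \<mu> (simplex_codebook (2 ^ b) r') (2 ^ b) \<epsilon> Q \<longrightarrow>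
        worst_err \<mu> (simplex_codebook (2 ^ b) r) (2 ^ b) (k_closest \<epsilon> (2 ^ b) k)
          \<le> worst_err \<mu> (simplex_codebook (2 ^ b) r') (2 ^ b) Q)"
proof -
  have "(2::nat) ^ 1 \<le> 2 ^ b" using assms(1) by (intro power_increasing) auto
  \<comment> \<open>The reference vector may be any unit vector; \<open>undefined\<close> merely
    names some coordinate.\<close>
  then interpret simplex_haar \<mu> "2 ^ b" \<epsilon> "axis undefined 1"
    by unfold_locales (use assms in auto)
  obtain k r where "k \<le> 2 ^ b" "0 < r"
    and opt: "random_encoder \<mu> (simplex_codebook (2 ^ b) r) (2 ^ b) (k_closest \<epsilon> (2 ^ b) (real k))"
    "is_unbiased \<mu> (simplex_codebook (2 ^ b) r) (2 ^ b) (k_closest \<epsilon> (2 ^ b) (real k))"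
    "is_ldp \<mu> (simplex_codebook (2 ^ b) r) (2 ^ b) \<epsilon> (k_closest \<epsilon> (2 ^ b) (real k))"
    "\<And>r' Q. 0 < r' \<Longrightarrow> random_encoder \<mu> (simplex_codebook (2 ^ b) r') (2 ^ b) Q
      \<Longrightarrow> is_unbiased \<mu> (simplex_codebook (2 ^ b) r') (2 ^ b) Q
      \<Longrightarrow> is_ldp \<mu> (simplex_codebook (2 ^ b) r') (2 ^ b) \<epsilon> Q
      \<Longrightarrow> worst_err \<mu> (simplex_codebook (2 ^ b) r) (2 ^ b) (k_closest \<epsilon> (2 ^ b) (real k))
        \<le> worst_err \<mu> (simplex_codebook (2 ^ b) r') (2 ^ b) Q"
    by (rule k_closest_optimal) blast
  moreover from \<open>k \<le> 2 ^ b\<close> have "real k \<le> real (2 ^ b)" by (simp only: of_nat_le_iff)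
  ultimately show ?thesis
    by (intro exI[of _ "real k"] exI[of _ r]) (simp add: opt)
qed

end
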